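(* Let $n\geq1$ be an integer and $1\leq k\leq n$. (1) If $\alpha,\beta>-1$, $|\beta|\leq1/2$, and $-1<\sigma\leq\sigma_\uparrow(\alpha,\beta)$, then \[ \theta_{n,k}^{(\alpha,\beta)}\leq\frac{j_{\alpha,k}}{n+\sigma}. \] (2) If $\alpha,\beta>-1$, $|\beta|\geq1/2$, and $\sigma\geq\sigma_\downarrow(\alpha,\beta)$, then \[ \theta_{n,k}^{(\alpha,\beta)}\geq\frac{j_{\alpha,k}}{n+\sigma}. \] In either part the inequality is strict unless $|\alpha|=|\beta|=\frac12$ and $\sigma=\frac{\alpha+\beta+1}{2}$, in which case equality holds for every admissible $n$ and $k$ (that is, all integers $n\ge1$ and $1\le k\le n$).
   Context: $P_n^{(\alpha,\beta)}$ denotes the Jacobi polynomial of degree $n$ (orthogonal on $(-1,1)$ with respect to the weight $(1-x)^\alpha(1+x)^\beta$). For $\alpha,\beta>-1$ its $n$ zeros are simple and lie in $(-1,1)$; they are written $\cos\theta_{n,k}^{(\alpha,\beta)}$, $1\le k\le n$, with $0<\theta_{n,1}^{(\alpha,\beta)}<\cdots<\theta_{n,n}^{(\alpha,\beta)}<\pi$. $j_{\alpha,k}$ denotes the $k$th positive zero of the Bessel function of the first kind $J_\alpha$. Put $\rho=\frac{\alpha+\beta+1}{2}$, $s_+=\max\{s,0\}$, and \[ \Phi_{\alpha,\beta}(x)=\frac{1-4\alpha^2}{16}\,\frac{1-x\cot x}{\sin^2x}+\frac{1-4\beta^2}{16}\,\frac{1+x\tan x}{\cos^2x},\qquad 0<x<\frac{\pi}{2}.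 \] For $|\beta|\le 1/2$, $m_{\alpha,\beta}=\inf_{0<x<\pi/2}\Phi_{\alpha,\beta}(x)$ (which is finite) and $\sigma_\uparrow(\alpha,\beta)=\rho-\frac{(-m_{\alpha,\beta})_+}{1+\rho}$. For $|\beta|\ge1/2$, $M_{\alpha,\beta}=\sup_{0<x<\pi/2}\Phi_{\alpha,\beta}(x)$ (which is finite) and $\sigma_\downarrow(\alpha,\beta)=\rho+\frac{(M_{\alpha,\beta})_+}{1+\rho}$. *)

theory Defs
  imports "HOL-Analysis.Analysis" "HOL-Computational_Algebra.Polynomial"
begin

text \<open>
  The Jacobi polynomial of degree \<open>n\<close>: orthogonal to all polynomials of smaller degree with respect
  to the weight \<open>(1 - x)\<^sup>\<alpha> (1 + x)\<^sup>\<beta>\<close> on \<open>(-1, 1)\<close>, with the classical normalization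
  \<open>P\<^sub>n(1) = (n + \<alpha> choose n)\<close>. It exists and is unique for \<open>\<alpha>, \<beta> > -1\<close>; its zeros do not depend
  on the normalization.
\<close>

definition is_jacobi_poly :: "real \<Rightarrow> real \<Rightarrow> nat \<Rightarrow> real poly \<Rightarrow> bool" where
  "is_jacobi_poly \<alpha> \<beta> n p \<longleftrightarrow>
     degree p = n \<and>
     (\<forall>q :: real poly. degree q < n \<longrightarrow>
        (LINT x:{-1<..<1}|lborel. poly p x * poly q x * ((1 - x) powr \<alpha> * (1 + x) powr \<beta>)) = 0) \<and>
     poly p 1 = (real n + \<alpha>) gchoose n"

definition jacobi_poly :: "real \<Rightarrow> real \<Rightarrow> nat \<Rightarrow> real poly" where
  "jacobi_poly \<alpha> \<beta> n = (THE p. is_jacobi_poly \<alpha> \<beta> n p)"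

text \<open>
  The Bessel function of the first kind by its power series; only the values at \<open>x > 0\<close> are used
  (\<open>powr\<close> is not meaningful for other arguments). \<open>rGamma\<close> is the reciprocal of \<open>Gamma\<close>.
\<close>

definition bessel_J :: "real \<Rightarrow> real \<Rightarrow> real" where
  "bessel_J \<alpha> x =
     (\<Sum>m. (-1) ^ m / fact m * rGamma (real m + \<alpha> + 1) * (x / 2) powr (2 * real m + \<alpha>))"

text \<open>
  The \<open>k\<close>-th smallest element of \<open>S\<close>, counted from \<open>k = 1\<close>. The set \<open>S\<close> may be infinite, provided
  that its initial segments are finite.
\<close>

definition kth_least :: "real set \<Rightarrow> nat \<Rightarrow> real" where
  "kth_least S k = (THE x. x \<in> S \<and> finite {y \<in> S. y \<le> x} \<and> card {y \<in> S. y \<le> x} = k)"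

text \<open>
  In the next two definitions zeros are listed without multiplicity, which is harmless: the zeros
  of Jacobi polynomials (\<open>\<alpha>, \<beta> > -1\<close>) and the positive zeros of Bessel functions are simple.
\<close>

definition jacobi_theta :: "real \<Rightarrow> real \<Rightarrow> nat \<Rightarrow> nat \<Rightarrow> real" where
  "jacobi_theta \<alpha> \<beta> n k = kth_least {\<theta>. 0 < \<theta> \<and> \<theta> < pi \<and> poly (jacobi_poly \<alpha> \<beta> n) (cos \<theta>) = 0} k"

definition bessel_zero :: "real \<Rightarrow> nat \<Rightarrow> real" where
  "bessel_zero \<alpha> k = kth_least {x. 0 < x \<and> bessel_J \<alpha> x = 0} k"

definition jacobi_rho :: "real \<Rightarrow> real \<Rightarrow> real" where
  "jacobi_rho \<alpha> \<beta> = (\<alpha> + \<beta> + 1) / 2"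

definition pos_part :: "real \<Rightarrow> real" where
  "pos_part s = max s 0"

definition jacobi_Phi :: "real \<Rightarrow> real \<Rightarrow> real \<Rightarrow> real" where
  "jacobi_Phi \<alpha> \<beta> x =
     (1 - 4 * \<alpha>\<^sup>2) / 16 * ((1 - x * cot x) / (sin x)\<^sup>2) +
     (1 - 4 * \<beta>\<^sup>2) / 16 * ((1 + x * tan x) / (cos x)\<^sup>2)"

text \<open>
  \<open>jacobi_Phi \<alpha> \<beta>\<close> is bounded below on \<open>(0, \<pi>/2)\<close> if \<open>\<bar>\<beta>\<bar> \<le> 1/2\<close> and bounded above if \<open>\<bar>\<beta>\<bar> \<ge> 1/2\<close>,
  so that the real-valued \<open>Inf\<close> and \<open>Sup\<close> below are the genuine infimum and supremum there.
\<close>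

definition jacobi_inf :: "real \<Rightarrow> real \<Rightarrow> real" where
  "jacobi_inf \<alpha> \<beta> = (INF x\<in>{0<..<pi/2}. jacobi_Phi \<alpha> \<beta> x)"

definition jacobi_sup :: "real \<Rightarrow> real \<Rightarrow> real" where
  "jacobi_sup \<alpha> \<beta> = (SUP x\<in>{0<..<pi/2}. jacobi_Phi \<alpha> \<beta> x)"

definition sigma_up :: "real \<Rightarrow> real \<Rightarrow> real" where
  "sigma_up \<alpha> \<beta> = jacobi_rho \<alpha> \<beta> - pos_part (- jacobi_inf \<alpha> \<beta>) / (1 + jacobi_rho \<alpha> \<beta>)"

definition sigma_down :: "real \<Rightarrow> real \<Rightarrow> real" where
  "sigma_down \<alpha> \<beta> = jacobi_rho \<alpha> \<beta> + pos_part (jacobi_sup \<alpha> \<beta>) / (1 + jacobi_rho \<alpha> \<beta>)"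

end

theory Submission
  imports Defs "HOL-Complex_Analysis.Complex_Analysis" "HOL-Real_Asymp.Real_Asymp"
begin

text \<open>
  The zeros of the Jacobi polynomial and of the Bessel function are compared by Sturm's theorem.
  After the substitution \<open>x = cos \<theta>\<close> and a change of the unknown that removes the first
  derivative (\<open>liouville_normal_form\<close>), the Jacobi polynomial becomes a solution on \<open>(0, \<pi>)\<close> of
  \<open>u'' + ((n + \<rho>)\<^sup>2 + (1/4 - \<alpha>\<^sup>2) / (4 sin\<^sup>2(\<theta>/2)) + (1/4 - \<beta>\<^sup>2) / (4 cos\<^sup>2(\<theta>/2))) u = 0\<close>,
  while \<open>\<surd>\<theta> J\<^sub>\<alpha>(c \<theta>)\<close>, whose zeros are \<open>j\<^sub>\<alpha>\<^sub>,\<^sub>k / c\<close>, solves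
  \<open>v'' + (c\<^sup>2 + (1/4 - \<alpha>\<^sup>2)/\<theta>\<^sup>2) v = 0\<close>. Both behave like \<open>\<theta>\<close> to the power \<open>\<alpha> + 1/2\<close>, times an even
  smooth function, at the singular endpoint 0, so their Wronskian vanishes there
  (\<open>wronskian_jacobi_bessel\<close>). Hence the endpoint 0 can play the role of a common zero in Sturm's
  theorem, and if one coefficient exceeds the other throughout \<open>(0, \<pi>)\<close>, then its solution has a
  zero before the first zero of the other solution, and one between any two consecutive zeros;
  counting gives the order of the \<open>k\<close>-th zeros (\<open>sturm_kth_zero_less\<close>).

  It remains to compare the coefficients. Write \<open>x = \<theta>/2\<close> and let \<open>p(x)\<close> be the sum of the two
  singular terms of the Jacobi coefficient. Then \<open>\<Phi>\<close> is exactly what measures the failure of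
  \<open>x\<^sup>2 p(x)\<close> to be constant: the derivative of \<open>x\<^sup>2 p(x)\<close> is \<open>2 x \<Phi>(x)\<close>. A bound \<open>m \<le> \<Phi>\<close> therefore
  integrates to \<open>p(x) \<ge> (1/4 - \<alpha>\<^sup>2)/\<theta>\<^sup>2 + m\<close> (\<open>trig_potential_ge\<close>), and Sturm's theorem applies with
  every \<open>c\<close> for which \<open>c\<^sup>2 < (n + \<rho>)\<^sup>2 + m\<close>. The formula for \<open>\<sigma>\<^sub>\<up>\<close> is a choice of \<open>c = n + \<sigma>\<close> that
  satisfies this for all \<open>n \<ge> 1\<close>, and part (2) is the same argument with all signs reversed.
  If the infimum of \<open>\<Phi>\<close> is nonnegative, \<open>c\<close> may be as large as \<open>n + \<rho>\<close>, and strictness has to come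
  from \<open>p(x) > (1/4 - \<alpha>\<^sup>2)/\<theta>\<^sup>2\<close>; this is \<open>trig_potential_gt\<close>, whose only exception is
  the absence of both singular terms. In that case \<open>|\<alpha>| = |\<beta>| = 1/2\<close>, and the strict comparison still holds for
  every \<open>c < n + \<rho>\<close> and, reversed, for every \<open>c > n + \<rho>\<close>, and letting \<open>c\<close> tend to \<open>n + \<rho>\<close> gives
  equality.

  The classical facts behind this are proved on the way. The differential equation of the Jacobi
  polynomial comes from an explicit expansion in powers of \<open>1 - x\<close>, orthogonality from the symmetry
  of the Jacobi operator, and the number of zeros in \<open>(-1, 1)\<close> from orthogonality. For the Bessel
  function, the power series gives the equation and the discreteness of the zeros, and Sturm's
  theorem against \<open>sin\<close> shows that there are infinitely many.
\<close>

section \<open>The k-th elements of two discrete sets\<close>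

text \<open>
  The defining property of \<open>kth_least\<close> as a relation, so that it can be established for a candidate
  and transported along maps before uniqueness is invoked.
\<close>

definition is_kth_least :: "real set \<Rightarrow> nat \<Rightarrow> real \<Rightarrow> bool" where
  "is_kth_least S k x \<longleftrightarrow> x \<in> S \<and> finite {y \<in> S. y \<le> x} \<and> card {y \<in> S. y \<le> x} = k"

lemma is_kth_least_unique:
  assumes "is_kth_least S k x" "is_kth_least S k y"
  shows "x = y"
proof -
  have *: False if "is_kth_least S k x" "is_kth_least S k y" "x < y" for x y
  proof -
    have "{z \<in> S. z \<le> x} \<subset> {z \<in> S. z \<le> y}"
    proof
      show "{z \<in> S. z \<le> x} \<subseteq> {z \<in> S. z \<le> y}" using \<open>x < y\<close> by auto
      have "y \<in> {z \<in> S. z \<le> y}" "y \<notin> {z \<in> S. z \<le> x}"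
        using that by (simp_all add: is_kth_least_def)
      then show "{z \<in> S. z \<le> x} \<noteq> {z \<in> S. z \<le> y}" by metis
    qed
    then have "card {z \<in> S. z \<le> x} < card {z \<in> S. z \<le> y}"
      using that by (intro psubset_card_mono) (auto simp: is_kth_least_def)
    then show False using that by (simp add: is_kth_least_def)
  qed
  show ?thesis using *[OF assms] *[OF assms(2,1)] by (meson linorder_neqE)
qed

lemma kth_least_eqI: "is_kth_least S k x \<Longrightarrow> kth_least S k = x"
  unfolding kth_least_def
  by (rule the_equality) (auto simp: is_kth_least_def[symmetric] intro: is_kth_least_unique)

lemma ex_kth_least_finite:
  fixes T :: "real set"
  assumes "finite T" "1 \<le> k" "k \<le> card T"
  shows "\<exists>x. is_kth_least T k x"
  using assms(2,3)
proof (induction k rule: nat_induct_at_least)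
  case base
  then have "T \<noteq> {}" by auto
  then have "Min T \<in> T" "\<And>y. y \<in> T \<Longrightarrow> Min T \<le> y" using assms(1) by auto
  then have "{y \<in> T. y \<le> Min T} = {Min T}" by fastforce
  then show ?case using assms(1) \<open>T \<noteq> {}\<close>
    by (intro exI[of _ "Min T"]) (auto simp: is_kth_least_def)
next
  case (Suc k)
  then obtain x where x: "is_kth_least T k x" by auto
  let ?R = "{y \<in> T. x < y}"
  have "?R \<noteq> {}"
  proof
    assume "?R = {}"
    then have "{y \<in> T. y \<le> x} = T" by force
    then show False using x Suc by (simp add: is_kth_least_def)
  qed
  moreover have fin: "finite ?R" using assms(1) by simp
  ultimately have m: "Min ?R \<in> ?R" by (rule Min_in[rotated])
  have le: "Min ?R \<le> y" if "y \<in> T" "x < y" for y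
    using that fin by (intro Min_le) auto
  have "{y \<in> T. y \<le> Min ?R} = insert (Min ?R) {y \<in> T. y \<le> x}"
  proof (intro set_eqI iffI)
    fix y assume "y \<in> {y \<in> T. y \<le> Min ?R}"
    then show "y \<in> insert (Min ?R) {y \<in> T. y \<le> x}"
      using le[of y] by (cases "x < y") auto
  qed (use m in auto)
  then show ?case using m x assms(1)
    by (intro exI[of _ "Min ?R"]) (auto simp: is_kth_least_def)
qed

lemma is_kth_least_kth_least:
  assumes fin: "\<And>x. finite {y \<in> S. y \<le> x}" and "1 \<le> k"
    and T: "finite T" "T \<subseteq> S" "k \<le> card T"
  shows "is_kth_least S k (kth_least S k)"
proof -
  define T' where "T' = {y \<in> S. y \<le> Max T}"
  have "T \<subseteq> T'" using T by (auto simp: T'_def)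
  moreover have "finite T'" using fin by (simp add: T'_def)
  ultimately have "k \<le> card T'" using T card_mono order_trans by metis
  with ex_kth_least_finite[OF \<open>finite T'\<close> \<open>1 \<le> k\<close>] obtain x where x: "is_kth_least T' k x"
    by auto
  then have "{y \<in> T'. y \<le> x} = {y \<in> S. y \<le> x}"
    by (auto simp: is_kth_least_def T'_def)
  with x have "is_kth_least S k x" by (auto simp: is_kth_least_def T'_def)
  with kth_least_eqI show ?thesis by metis
qed

lemma is_kth_least_divide:
  assumes "is_kth_least S k x" "c > 0"
  shows "is_kth_least {t. c * t \<in> S} k (x / c)"
proof -
  have eq: "{y \<in> {t. c * t \<in> S}. y \<le> x / c} = (\<lambda>t. t / c) ` {y \<in> S. y \<le> x}"
  proof (intro set_eqI iffI)
    fix y assume "y \<in> {y \<in> {t. c * t \<in> S}. y \<le> x / c}"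
    then show "y \<in> (\<lambda>t. t / c) ` {y \<in> S. y \<le> x}"
      using assms(2) by (intro image_eqI[of _ _ "c * y"]) (auto simp: field_simps)
  qed (use assms(2) in \<open>auto simp: divide_right_mono\<close>)
  have "inj_on (\<lambda>t. t / c) {y \<in> S. y \<le> x}" using assms(2) by (auto simp: inj_on_def)
  then show ?thesis using assms unfolding is_kth_least_def eq
    by (auto simp: card_image)
qed

text \<open>
  Each of the first \<open>k\<close> elements \<open>y\<close> of \<open>A\<close> has an element of \<open>B\<close> of its own: one below \<open>y\<close> but above
  the predecessor of \<open>y\<close> in \<open>A\<close>. So at least \<open>k\<close> elements of \<open>B\<close> precede the \<open>k\<close>-th element of \<open>A\<close>.
\<close>

lemma kth_least_less:
  assumes a: "is_kth_least A k a" and b: "is_kth_least B k b"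
    and sep: "\<And>y. y \<in> A \<Longrightarrow> y \<le> a \<Longrightarrow> \<exists>z\<in>B. z < y \<and> (\<forall>x\<in>A. x < y \<longrightarrow> x < z)"
  shows "b < a"
proof (rule ccontr)
  assume "\<not> b < a"
  obtain f where f: "\<And>y. y \<in> A \<Longrightarrow> y \<le> a \<Longrightarrow> f y \<in> B \<and> f y < y \<and> (\<forall>x\<in>A. x < y \<longrightarrow> x < f y)"
    using sep by metis
  have "strict_mono_on {y \<in> A. y \<le> a} f"
  proof (rule strict_mono_onI)
    fix r s assume "r \<in> {y \<in> A. y \<le> a}" "s \<in> {y \<in> A. y \<le> a}" "r < s"
    then have "f r < r" "r < f s" using f[of r] f[of s] by auto
    then show "f r < f s" by simp
  qed
  then have "inj_on f {y \<in> A. y \<le> a}" by (rule strict_mono_on_imp_inj_on)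
  moreover have "f ` {y \<in> A. y \<le> a} \<subseteq> {z \<in> B. z \<le> b} - {b}"
    using f \<open>\<not> b < a\<close> by fastforce
  ultimately have "card {y \<in> A. y \<le> a} \<le> card ({z \<in> B. z \<le> b} - {b})"
    using b by (intro card_inj_on_le) (auto simp: is_kth_least_def)
  also have "\<dots> < card {z \<in> B. z \<le> b}"
    using b by (intro card_Diff1_less) (auto simp: is_kth_least_def)
  finally show False using a b by (simp add: is_kth_least_def)
qed

section \<open>Sturm comparison from a singular endpoint\<close>

text \<open>
  The second-order equation \<open>u'' + Q u = 0\<close>, with the derivative carried along as a separate function
  because the Wronskian is a bilinear expression in \<open>u\<close> and \<open>u'\<close>.
\<close>

definition solves_on :: "real set \<Rightarrow> (real \<Rightarrow> real) \<Rightarrow> (real \<Rightarrow> real) \<Rightarrow> (real \<Rightarrow> real) \<Rightarrow> bool" where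
  "solves_on I Q u u' \<longleftrightarrow>
     (\<forall>x\<in>I. (u has_real_derivative u' x) (at x) \<and> (u' has_real_derivative - Q x * u x) (at x))"

lemma solves_on_mono: "solves_on I Q u u' \<Longrightarrow> J \<subseteq> I \<Longrightarrow> solves_on J Q u u'"
  by (auto simp: solves_on_def)

lemma solves_on_uminus: "solves_on I Q u u' \<Longrightarrow> solves_on I Q (\<lambda>x. - u x) (\<lambda>x. - u' x)"
  by (auto simp: solves_on_def intro!: derivative_eq_intros)

lemma solves_on_continuous: "solves_on I Q u u' \<Longrightarrow> continuous_on I u"
  by (intro continuous_at_imp_continuous_on) (auto simp: solves_on_def intro: DERIV_isCont)

text \<open>
  The derivative of the Wronskian \<open>u v' - u' v\<close> is \<open>(Q - q) u v > 0\<close>, so it cannot start from a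
  nonnegative and end at a nonpositive value. The boundary values enter as one-sided limits, because
  the equations may be singular at the endpoints.
\<close>

lemma wronskian_contradiction:
  assumes "a < b"
    and u: "solves_on {a<..<b} Q u u'" and v: "solves_on {a<..<b} q v v'"
    and less: "\<And>x. a < x \<Longrightarrow> x < b \<Longrightarrow> q x < Q x"
    and upos: "\<And>x. a < x \<Longrightarrow> x < b \<Longrightarrow> u x > 0"
    and vpos: "\<And>x. a < x \<Longrightarrow> x < b \<Longrightarrow> v x > 0"
    and A: "((\<lambda>x. u x * v' x - u' x * v x) \<longlongrightarrow> A) (at_right a)" "0 \<le> A"
    and B: "((\<lambda>x. u x * v' x - u' x * v x) \<longlongrightarrow> B) (at_left b)" "B \<le> 0"
  shows False
proof -
  define W where "W = (\<lambda>x. u x * v' x - u' x * v x)"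
  have mono: "W x < W y" if "a < x" "x < y" "y < b" for x y
  proof (rule DERIV_pos_imp_increasing[OF \<open>x < y\<close>])
    fix t assume t: "x \<le> t" "t \<le> y"
    then have "(W has_real_derivative (Q t - q t) * (u t * v t)) (at t)"
      using u v that unfolding W_def solves_on_def
      by (auto intro!: derivative_eq_intros simp: algebra_simps)
    moreover have "(Q t - q t) * (u t * v t) > 0"
      using t that less[of t] upos[of t] vpos[of t] by simp
    ultimately show "\<exists>y. (W has_real_derivative y) (at t) \<and> 0 < y" by blast
  qed
  define p where "p = (2 * a + b) / 3"
  define r where "r = (a + 2 * b) / 3"
  have pr: "a < p" "p < r" "r < b" using \<open>a < b\<close> by (auto simp: p_def r_def)
  have "A \<le> W p"
  proof (rule tendsto_upperbound)
    show "\<forall>\<^sub>F x in at_right a. W x \<le> W p"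
      using eventually_at_right_real[OF \<open>a < p\<close>]
      by eventually_elim (use mono[of _ p] pr in \<open>auto intro: less_imp_le\<close>)
  qed (use A in \<open>auto simp: W_def\<close>)
  moreover have "W r \<le> B"
  proof (rule tendsto_lowerbound)
    show "\<forall>\<^sub>F x in at_left b. W r \<le> W x"
      using eventually_at_left_real[OF \<open>r < b\<close>]
      by eventually_elim (use mono[of r] pr in \<open>auto intro: less_imp_le\<close>)
  qed (use B in \<open>auto simp: W_def\<close>)
  ultimately show False using mono[of p r] pr A(2) B(2) by simp
qed

lemma deriv_nonneg_at_left_zero:
  assumes "(v has_real_derivative d) (at a)" "v a = 0" "a < b" "\<And>x. a < x \<Longrightarrow> x < b \<Longrightarrow> v x > 0"
  shows "0 \<le> d"
proof (rule ccontr)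
  assume "\<not> 0 \<le> d"
  then obtain e where e: "e > 0" "\<And>h. h > 0 \<Longrightarrow> h < e \<Longrightarrow> v (a + h) < v a"
    using DERIV_neg_dec_right[OF assms(1)] by auto
  define h where "h = min e (b - a) / 2"
  have "h > 0" "h < e" "a + h < b" using e(1) assms(3) by (auto simp: h_def min_def field_simps)
  then show False using e(2)[of h] assms(2) assms(4)[of "a + h"] by simp
qed

lemma deriv_nonpos_at_right_zero:
  assumes "(v has_real_derivative d) (at b)" "v b = 0" "a < b" "\<And>x. a < x \<Longrightarrow> x < b \<Longrightarrow> v x > 0"
  shows "d \<le> 0"
proof -
  have "((\<lambda>x. v (- x)) has_real_derivative - d) (at (- b))"
    using DERIV_mirror[of v d "-b"] assms(1) by simp
  from deriv_nonneg_at_left_zero[OF this, of "- a"] show ?thesis using assms(2,3,4) by simp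
qed

lemma nonzero_imp_constant_sign:
  fixes f :: "real \<Rightarrow> real"
  assumes "continuous_on {a<..<b} f" "\<And>x. a < x \<Longrightarrow> x < b \<Longrightarrow> f x \<noteq> 0"
  shows "(\<forall>x. a < x \<and> x < b \<longrightarrow> f x > 0) \<or> (\<forall>x. a < x \<and> x < b \<longrightarrow> f x < 0)"
proof (rule ccontr)
  assume "\<not> ?thesis"
  then obtain x y where xy: "a < x" "x < b" "f x < 0" "a < y" "y < b" "f y > 0"
    using assms(2) by (metis linorder_neqE_linordered_idom)
  have "connected (f ` {a<..<b})"
    using assms(1) by (intro connected_continuous_image) auto
  moreover have "f x \<in> f ` {a<..<b}" "f y \<in> f ` {a<..<b}" using xy by auto
  ultimately have "0 \<in> f ` {a<..<b}" using connectedD_interval xy(3,6) by (metis less_imp_le)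
  then show False using assms(2) by auto
qed

text \<open>
  If \<open>u\<close> had no zero, both \<open>u\<close> and \<open>v\<close> would have constant sign, say positive. At a zero of \<open>v\<close>
  the Wronskian reduces to \<open>u v'\<close>, whose sign is that of \<open>v'\<close>: nonnegative where \<open>v\<close> becomes positive
  and nonpositive where it returns to 0. This contradicts \<open>wronskian_contradiction\<close>. The left end \<open>p\<close> may
  also be the endpoint \<open>a\<close> of the domain, where the zero of \<open>v\<close> is replaced by a vanishing Wronskian.
\<close>

lemma sturm_zero_between:
  assumes ab: "a < b" "b < c"
    and u: "solves_on {a<..<c} Q u u'" and v: "solves_on {a<..<c} q v v'"
    and less: "\<And>x. a < x \<Longrightarrow> x < c \<Longrightarrow> q x < Q x"
    and p: "p = a \<and> ((\<lambda>x. u x * v' x - u' x * v x) \<longlongrightarrow> 0) (at_right a) \<or> a < p \<and> v p = 0"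
    and b: "p < b" "v b = 0"
    and v0: "\<And>x. p < x \<Longrightarrow> x < b \<Longrightarrow> v x \<noteq> 0"
  shows "\<exists>z. p < z \<and> z < b \<and> u z = 0"
proof (rule ccontr)
  assume *: "\<not> ?thesis"
  have "a \<le> p" using p by auto
  have key: False
    if u: "solves_on {a<..<c} Q u u'" and v: "solves_on {a<..<c} q v v'"
      and upos: "\<And>x. p < x \<Longrightarrow> x < b \<Longrightarrow> u x > 0"
      and vpos: "\<And>x. p < x \<Longrightarrow> x < b \<Longrightarrow> v x > 0"
      and p: "p = a \<and> ((\<lambda>x. u x * v' x - u' x * v x) \<longlongrightarrow> 0) (at_right a) \<or> a < p \<and> v p = 0"
      and vb: "v b = 0"
    for u u' v v'
  proof -
    let ?W = "\<lambda>x. u x * v' x - u' x * v x"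
    have cont: "isCont u x" "isCont u' x" "isCont v x" "isCont v' x" if "a < x" "x < c" for x
      using that u v by (auto simp: solves_on_def intro: DERIV_isCont)
    have contW: "isCont ?W x" if "a < x" "x < c" for x
      using cont[OF that] by (intro continuous_intros)
    have dv: "(v has_real_derivative v' x) (at x)" if "a < x" "x < c" for x
      using v that by (auto simp: solves_on_def)
    have "u b \<ge> 0"
    proof (rule tendsto_lowerbound)
      show "(u \<longlongrightarrow> u b) (at_left b)"
        using cont(1)[of b] ab by (simp add: isCont_def filterlim_at_split)
      show "\<forall>\<^sub>F x in at_left b. 0 \<le> u x"
        using eventually_at_left_real[OF \<open>p < b\<close>]
        by eventually_elim (use upos in force)
    qed auto
    moreover have "v' b \<le> 0"
      using deriv_nonpos_at_right_zero[OF dv, of b p] \<open>p < b\<close> vb ab vpos by auto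
    ultimately have B: "?W b \<le> 0" using vb by (simp add: mult_nonneg_nonpos)
    have WB: "(?W \<longlongrightarrow> ?W b) (at_left b)"
      using contW[of b] ab by (simp add: isCont_def filterlim_at_split)
    obtain A where A: "(?W \<longlongrightarrow> A) (at_right p)" "0 \<le> A"
    proof (cases "p = a")
      case True
      then show ?thesis using p that by blast
    next
      case False
      then have ap: "a < p" using \<open>a \<le> p\<close> by simp
      have "u p \<ge> 0"
      proof (rule tendsto_lowerbound)
        show "(u \<longlongrightarrow> u p) (at_right p)"
          using cont(1)[of p] ab ap \<open>p < b\<close> by (simp add: isCont_def filterlim_at_split)
        show "\<forall>\<^sub>F x in at_right p. 0 \<le> u x"
          using eventually_at_right_real[OF \<open>p < b\<close>]
          by eventually_elim (use upos in force)
      qed auto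
      moreover have "v' p \<ge> 0"
        using deriv_nonneg_at_left_zero[OF dv, of p b] \<open>p < b\<close> p False ap ab vpos by auto
      ultimately have "0 \<le> ?W p" using p False by simp
      moreover have "(?W \<longlongrightarrow> ?W p) (at_right p)"
        using contW[of p] ap \<open>p < b\<close> ab by (simp add: isCont_def filterlim_at_split)
      ultimately show ?thesis using that by blast
    qed
    show False
    proof (rule wronskian_contradiction[OF \<open>p < b\<close>, of Q u u' q v v'])
      show "solves_on {p<..<b} Q u u'" "solves_on {p<..<b} q v v'"
        by (rule solves_on_mono[OF u] solves_on_mono[OF v]; use \<open>a \<le> p\<close> ab in force)+
    qed (use less \<open>a \<le> p\<close> ab upos vpos A B WB in auto)
  qed
  have sub: "{p<..<b} \<subseteq> {a<..<c}" using \<open>a \<le> p\<close> ab by auto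
  have "(\<forall>x. p < x \<and> x < b \<longrightarrow> u x > 0) \<or> (\<forall>x. p < x \<and> x < b \<longrightarrow> u x < 0)"
    using * by (intro nonzero_imp_constant_sign continuous_on_subset[OF solves_on_continuous[OF u] sub]) auto
  moreover have "(\<forall>x. p < x \<and> x < b \<longrightarrow> v x > 0) \<or> (\<forall>x. p < x \<and> x < b \<longrightarrow> v x < 0)"
    using v0 by (intro nonzero_imp_constant_sign continuous_on_subset[OF solves_on_continuous[OF v] sub]) auto
  moreover
  have "p = a \<and> ((\<lambda>x. u' x * v x - u x * v' x) \<longlongrightarrow> 0) (at_right a) \<or> a < p \<and> v p = 0"
    using p tendsto_minus[of "\<lambda>x. u x * v' x - u' x * v x" 0] by (auto simp: algebra_simps)
  note p' = this
  note um = solves_on_uminus[OF u] and vm = solves_on_uminus[OF v]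
  ultimately show False
    using key[OF u v] key[OF um v] key[OF u vm] key[OF um vm] p p' b(2)
    by (auto simp: algebra_simps)
qed

text \<open>
  The interval used for a zero \<open>b\<close> of \<open>v\<close> starts at the preceding zero, or at \<open>a\<close> if there is none.
  The sets \<open>S\<close> and \<open>T\<close> only have to agree with the zeros inside \<open>(a, c)\<close>, so that \<open>S\<close> may be the set of all
  positive zeros of a function that lives on a longer interval.
\<close>

lemma sturm_kth_zero_less:
  assumes "a < c"
    and u: "solves_on {a<..<c} Q u u'" and v: "solves_on {a<..<c} q v v'"
    and less: "\<And>x. a < x \<Longrightarrow> x < c \<Longrightarrow> q x < Q x"
    and W: "((\<lambda>x. u x * v' x - u' x * v x) \<longlongrightarrow> 0) (at_right a)"
    and y: "is_kth_least S k y" "y < c" and z: "is_kth_least T k z"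
    and S: "\<And>x. x < c \<Longrightarrow> x \<in> S \<longleftrightarrow> a < x \<and> v x = 0"
    and T: "\<And>x. a < x \<Longrightarrow> x < c \<Longrightarrow> u x = 0 \<Longrightarrow> x \<in> T"
  shows "z < y"
proof (rule kth_least_less[OF y(1) z])
  fix b assume b: "b \<in> S" "b \<le> y"
  \<comment> \<open>its maximum is the predecessor of b, or a\<close>
  define P where "P = insert a {x \<in> S. x < b}"
  have "finite {x \<in> S. x < b}"
    by (rule finite_subset[of _ "{x \<in> S. x \<le> y}"]) (use b y in \<open>auto simp: is_kth_least_def\<close>)
  then have fin: "finite P" by (simp add: P_def)
  then have MP: "Max P \<in> P" by (intro Max_in) (auto simp: P_def)
  have "a < b" "b < c" using S[of b] b y(2) by auto
  then have ap: "a \<le> Max P" "Max P < b" "v b = 0"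
    and p: "Max P = a \<or> a < Max P \<and> v (Max P) = 0"
    using fin MP S[of "Max P"] S[of b] b by (auto simp: P_def)
  have v0: "v x \<noteq> 0" if "Max P < x" "x < b" for x
  proof
    assume "v x = 0"
    then have "x \<in> P" using S[of x] that ap \<open>b < c\<close> by (auto simp: P_def)
    then have "x \<le> Max P" using fin by simp
    then show False using that by simp
  qed
  obtain t where t: "Max P < t" "t < b" "u t = 0"
    using sturm_zero_between[OF \<open>a < b\<close> \<open>b < c\<close> u v less _ ap(2,3) v0] p W by auto
  have "t \<in> T" using T[of t] t ap \<open>b < c\<close> by auto
  moreover have "\<forall>x\<in>S. x < b \<longrightarrow> x < t"
  proof (intro ballI impI)
    fix x assume "x \<in> S" "x < b"
    then have "x \<in> P" by (simp add: P_def)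
    then have "x \<le> Max P" using fin by simp
    then show "x < t" using t by simp
  qed
  ultimately show "\<exists>z\<in>T. z < b \<and> (\<forall>x\<in>S. x < b \<longrightarrow> x < z)" using t by blast
qed

lemma solves_on_cong: "solves_on I Q u u' \<Longrightarrow> (\<And>x. x \<in> I \<Longrightarrow> Q x = Q' x) \<Longrightarrow> solves_on I Q' u u'"
  by (auto simp: solves_on_def)

text \<open>
  The equation \<open>U'' + r U' + s U = 0\<close> loses its first-order term for \<open>A U\<close> when the factor \<open>A\<close> satisfies
  \<open>A' = A r / 2\<close>.
\<close>

lemma liouville_normal_form:
  assumes A: "\<And>x. x \<in> I \<Longrightarrow> (A has_real_derivative A x * (r x / 2)) (at x)"
    and r: "\<And>x. x \<in> I \<Longrightarrow> (r has_real_derivative r' x) (at x)"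
    and U: "\<And>x. x \<in> I \<Longrightarrow> (U has_real_derivative U' x) (at x)"
    and U': "\<And>x. x \<in> I \<Longrightarrow> (U' has_real_derivative - (r x * U' x + s x * U x)) (at x)"
  shows "solves_on I (\<lambda>x. s x - (r x)\<^sup>2 / 4 - r' x / 2) (\<lambda>x. A x * U x)
           (\<lambda>x. A x * (U' x + r x / 2 * U x))"
  unfolding solves_on_def
proof (intro ballI conjI)
  fix x assume x: "x \<in> I"
  show "((\<lambda>x. A x * U x) has_real_derivative A x * (U' x + r x / 2 * U x)) (at x)"
    by (rule derivative_eq_intros A[OF x] U[OF x] refl)+ (simp add: algebra_simps)
  show "((\<lambda>x. A x * (U' x + r x / 2 * U x)) has_real_derivative
          - (s x - (r x)\<^sup>2 / 4 - r' x / 2) * (A x * U x)) (at x)"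
    by (rule derivative_eq_intros A[OF x] U[OF x] U'[OF x] r[OF x] refl | simp)+
       (simp add: field_simps power2_eq_square)
qed

section \<open>Jacobi polynomials: differential equation, orthogonality, zeros\<close>

text \<open>
  The Jacobi differential operator; the Jacobi polynomials are its eigenvectors for the eigenvalues
  \<open>- jacobi_eigenvalue \<alpha> \<beta> n\<close>.
\<close>

definition jacobi_op :: "real \<Rightarrow> real \<Rightarrow> real poly \<Rightarrow> real poly" where
  "jacobi_op \<alpha> \<beta> p = [:1, 0, -1:] * pderiv (pderiv p) + [:\<beta> - \<alpha>, - (\<alpha> + \<beta> + 2):] * pderiv p"

definition jacobi_eigenvalue :: "real \<Rightarrow> real \<Rightarrow> nat \<Rightarrow> real" where
  "jacobi_eigenvalue \<alpha> \<beta> n = real n * (real n + \<alpha> + \<beta> + 1)"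

lemma jacobi_op_add: "jacobi_op \<alpha> \<beta> (p + q) = jacobi_op \<alpha> \<beta> p + jacobi_op \<alpha> \<beta> q"
  unfolding jacobi_op_def pderiv_add distrib_left by (simp only: ac_simps)

lemma jacobi_op_smult: "jacobi_op \<alpha> \<beta> (smult c p) = smult c (jacobi_op \<alpha> \<beta> p)"
  by (simp add: jacobi_op_def pderiv_smult smult_add_right)

text \<open>
  In the basis of the powers of \<open>1 - x\<close> the operator is bidiagonal, which is why this basis is used for
  the explicit eigenvector and for the test functions below.
\<close>

lemma jacobi_op_power:
  "jacobi_op \<alpha> \<beta> ([:1, -1:] ^ m) =
     smult (2 * real m * (real m + \<alpha>)) ([:1, -1:] ^ (m - 1)) -
     smult (jacobi_eigenvalue \<alpha> \<beta> m) ([:1, -1:] ^ m)"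
proof -
  have d: "pderiv ([:1, -1 :: real:] ^ Suc k) = smult (- real (Suc k)) ([:1, -1:] ^ k)" for k
    by (subst pderiv_power_Suc) (simp add: pderiv_pCons)
  consider "m = 0" | "m = 1" | k where "m = Suc (Suc k)"
    by (metis One_nat_def not0_implies_Suc)
  then show ?thesis
  proof cases
    case 1
    then show ?thesis by (simp add: jacobi_op_def jacobi_eigenvalue_def)
  next
    case 2
    then show ?thesis
      by (simp add: jacobi_op_def jacobi_eigenvalue_def pderiv_pCons algebra_simps)
  next
    case 3
    have "poly (jacobi_op \<alpha> \<beta> ([:1, -1:] ^ Suc (Suc k))) x =
       poly (smult (2 * real (Suc (Suc k)) * (real (Suc (Suc k)) + \<alpha>)) ([:1, -1:] ^ Suc k) -
       smult (jacobi_eigenvalue \<alpha> \<beta> (Suc (Suc k))) ([:1, -1:] ^ (Suc (Suc k)))) x" for x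
      unfolding jacobi_op_def d pderiv_smult
      by (simp add: jacobi_eigenvalue_def algebra_simps)
    then show ?thesis using 3 by (simp add: poly_eq_poly_eq_iff[symmetric] fun_eq_iff)
  qed
qed

lemma jacobi_eigenvalue_less:
  assumes "\<alpha> > -1" "\<beta> > -1" "m < n"
  shows "jacobi_eigenvalue \<alpha> \<beta> m < jacobi_eigenvalue \<alpha> \<beta> n"
proof -
  have "jacobi_eigenvalue \<alpha> \<beta> n - jacobi_eigenvalue \<alpha> \<beta> m =
      (real n - real m) * (real n + real m + \<alpha> + \<beta> + 1)"
    by (simp add: jacobi_eigenvalue_def algebra_simps)
  moreover have "real n \<ge> 1" using assms(3) by simp
  ultimately show ?thesis using assms
    by (smt (verit) mult_pos_pos of_nat_less_iff of_nat_0_le_iff)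
qed

text \<open>
  The recursion expresses that the eigenvector equation holds in the bidiagonal form of the operator.
  The start value is the prescribed value at \<open>x = 1\<close>, where only the constant term survives.
\<close>

primrec jacobi_coeff :: "real \<Rightarrow> real \<Rightarrow> nat \<Rightarrow> nat \<Rightarrow> real" where
  "jacobi_coeff \<alpha> \<beta> n 0 = (real n + \<alpha>) gchoose n"
| "jacobi_coeff \<alpha> \<beta> n (Suc m) =
     - (jacobi_eigenvalue \<alpha> \<beta> n - jacobi_eigenvalue \<alpha> \<beta> m) /
       (2 * real (Suc m) * (real (Suc m) + \<alpha>)) * jacobi_coeff \<alpha> \<beta> n m"

definition jacobi_series :: "real \<Rightarrow> real \<Rightarrow> nat \<Rightarrow> real poly" where
  "jacobi_series \<alpha> \<beta> n = (\<Sum>m\<le>n. smult (jacobi_coeff \<alpha> \<beta> n m) ([:1, -1:] ^ m))"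

text \<open>
  For a partial sum all contributions cancel in pairs except for one term in the last power. That
  term carries the difference of two eigenvalues, which is 0 when the sum is complete.
\<close>

lemma jacobi_op_series:
  assumes "\<alpha> > -1"
  shows "jacobi_op \<alpha> \<beta> (jacobi_series \<alpha> \<beta> n) = smult (- jacobi_eigenvalue \<alpha> \<beta> n) (jacobi_series \<alpha> \<beta> n)"
proof -
  define l where "l = jacobi_eigenvalue \<alpha> \<beta>"
  define S where "S N = (\<Sum>m\<le>N. smult (jacobi_coeff \<alpha> \<beta> n m) ([:1, -1:] ^ m))" for N
  have "jacobi_op \<alpha> \<beta> (S N) + smult (l n) (S N) =
          smult ((l n - l N) * jacobi_coeff \<alpha> \<beta> n N) ([:1, -1:] ^ N)" for N
  proof (induction N)
    case 0
    then show ?case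
      by (simp add: S_def jacobi_op_def l_def jacobi_eigenvalue_def pderiv_pCons)
  next
    case (Suc N)
    define c where "c = jacobi_coeff \<alpha> \<beta> n"
    have "real (Suc N) + \<alpha> > 0" using assms by simp
    then have c: "c (Suc N) * (2 * real (Suc N) * (real (Suc N) + \<alpha>)) = - ((l n - l N) * c N)"
      unfolding c_def l_def jacobi_coeff.simps by (simp del: of_nat_Suc) (simp add: left_diff_distrib)
    have "jacobi_op \<alpha> \<beta> (S (Suc N)) + smult (l n) (S (Suc N)) =
      (jacobi_op \<alpha> \<beta> (S N) + smult (l n) (S N)) +
      smult (c (Suc N)) (jacobi_op \<alpha> \<beta> ([:1, -1:] ^ Suc N)) + smult (l n * c (Suc N)) ([:1, -1:] ^ Suc N)"
      by (simp add: S_def jacobi_op_add jacobi_op_smult c_def smult_add_right del: power_Suc)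
    also have "\<dots> = smult ((l n - l N) * c N) ([:1, -1:] ^ N) +
      smult (c (Suc N) * (2 * real (Suc N) * (real (Suc N) + \<alpha>))) ([:1, -1:] ^ N) +
      smult ((l n - l (Suc N)) * c (Suc N)) ([:1, -1:] ^ Suc N)"
      unfolding Suc.IH[folded c_def] jacobi_op_power l_def[symmetric]
      by (simp add: smult_diff_right smult_diff_left left_diff_distrib right_diff_distrib mult.commute del: power_Suc of_nat_Suc)
    also have "\<dots> = smult ((l n - l (Suc N)) * c (Suc N)) ([:1, -1:] ^ Suc N)"
      unfolding c by (simp del: power_Suc)
    finally show ?case by (simp add: c_def del: power_Suc)
  qed
  from this[of n] have "jacobi_op \<alpha> \<beta> (S n) = - smult (l n) (S n)"
    by (simp add: eq_neg_iff_add_eq_0)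
  then show ?thesis by (simp add: S_def l_def jacobi_series_def)
qed

lemma gchoose_pos: "(real n + \<alpha>) gchoose n > 0" if "\<alpha> > -1"
  unfolding gbinomial_pochhammer' using that by (auto intro!: divide_pos_pos pochhammer_pos)

lemma poly_jacobi_series_1: "poly (jacobi_series \<alpha> \<beta> n) 1 = (real n + \<alpha>) gchoose n"
proof -
  have "poly (jacobi_series \<alpha> \<beta> n) 1 = (\<Sum>m\<le>n. if m = 0 then jacobi_coeff \<alpha> \<beta> n 0 else 0)"
    unfolding jacobi_series_def poly_sum by (intro sum.cong) (auto simp: power_0_left)
  then show ?thesis by simp
qed

lemma jacobi_coeff_nonzero:
  assumes "\<alpha> > -1" "\<beta> > -1" "m \<le> n"
  shows "jacobi_coeff \<alpha> \<beta> n m \<noteq> 0"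
  using assms(3)
proof (induction m)
  case 0
  then show ?case using gchoose_pos[OF assms(1), of n] by simp
next
  case (Suc m)
  have "real (Suc m) + \<alpha> \<noteq> 0" using assms(1) by simp
  moreover have "jacobi_eigenvalue \<alpha> \<beta> m < jacobi_eigenvalue \<alpha> \<beta> n"
    using jacobi_eigenvalue_less[OF assms(1,2)] Suc by simp
  ultimately show ?case using Suc by (simp del: of_nat_Suc)
qed

lemma coeff_one_minus_power:
  "coeff ([:1, -1 :: real:] ^ m) m = (-1) ^ m" "i > m \<Longrightarrow> coeff ([:1, -1 :: real:] ^ m) i = 0"
proof -
  have d: "degree ([:1, -1 :: real:] ^ m) = m" by (simp add: degree_power_eq)
  have "lead_coeff ([:1, -1 :: real:] ^ m) = (-1) ^ m" by (simp add: lead_coeff_power)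
  then show "coeff ([:1, -1 :: real:] ^ m) m = (-1) ^ m" by (simp add: d)
  show "i > m \<Longrightarrow> coeff ([:1, -1 :: real:] ^ m) i = 0" by (simp add: coeff_eq_0 d)
qed

lemma degree_jacobi_series:
  assumes "\<alpha> > -1" "\<beta> > -1"
  shows "degree (jacobi_series \<alpha> \<beta> n) = n"
proof (rule antisym)
  show "degree (jacobi_series \<alpha> \<beta> n) \<le> n"
    unfolding jacobi_series_def
    by (intro degree_sum_le) (auto intro!: order_trans[OF degree_smult_le] simp: degree_power_eq)
  have "coeff (jacobi_series \<alpha> \<beta> n) n =
      (\<Sum>m\<le>n. if m = n then jacobi_coeff \<alpha> \<beta> n n * (-1) ^ n else 0)"
    unfolding jacobi_series_def coeff_sum
    by (intro sum.cong) (auto simp: coeff_one_minus_power)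
  also have "\<dots> \<noteq> 0" using jacobi_coeff_nonzero[OF assms, of n n] by simp
  finally show "n \<le> degree (jacobi_series \<alpha> \<beta> n)" by (rule le_degree)
qed

definition jacobi_weight :: "real \<Rightarrow> real \<Rightarrow> real \<Rightarrow> real" where
  "jacobi_weight \<alpha> \<beta> x = (1 - x) powr \<alpha> * (1 + x) powr \<beta>"

definition jacobi_integral :: "real \<Rightarrow> real \<Rightarrow> real poly \<Rightarrow> real" where
  "jacobi_integral \<alpha> \<beta> q = (LINT x:{-1<..<1}|lborel. poly q x * jacobi_weight \<alpha> \<beta> x)"

text \<open>
  The weight is an affine rescaling of the integrand of the Beta function.
\<close>

lemma set_integrable_jacobi_weight:
  assumes "\<alpha> > -1" "\<beta> > -1"
  shows "set_integrable lborel {-1<..<1} (jacobi_weight \<alpha> \<beta>)"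
proof -
  define f where "f = (\<lambda>t::real. indicator {0..1} t *\<^sub>R (t powr \<beta> * (1 - t) powr \<alpha>))"
  have "integrable lborel f"
    using integrable_Beta[of "\<beta> + 1" "\<alpha> + 1"] assms unfolding f_def set_integrable_def by simp
  then have "integrable lborel (\<lambda>x. f (1 / 2 + 1 / 2 * x))"
    by (rule lborel_integrable_real_affine) simp
  then have i: "integrable lborel (\<lambda>x. 2 powr (\<alpha> + \<beta>) * f (1 / 2 + 1 / 2 * x))"
    by (rule integrable_mult_right)
  have eq: "2 powr (\<alpha> + \<beta>) * f (1 / 2 + 1 / 2 * x) = indicator {-1..1} x *\<^sub>R jacobi_weight \<alpha> \<beta> x" for x
  proof (cases "x \<in> {-1..1}")
    case True
    have "(1/2 + 1/2 * x) powr \<beta> = (1 + x) powr \<beta> / 2 powr \<beta>"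
         "(1 - (1/2 + 1/2 * x)) powr \<alpha> = (1 - x) powr \<alpha> / 2 powr \<alpha>"
      using True by (subst powr_divide[symmetric]; simp add: field_simps)+
    then show ?thesis using True
      by (simp add: f_def jacobi_weight_def indicator_def powr_add)
  qed (auto simp: f_def indicator_def)
  have "set_integrable lborel {-1..1} (jacobi_weight \<alpha> \<beta>)"
    using i unfolding eq set_integrable_def .
  then show ?thesis by (rule set_integrable_subset) auto
qed

lemma set_integrable_poly_jacobi_weight:
  assumes "\<alpha> > -1" "\<beta> > -1"
  shows "set_integrable lborel {-1<..<1} (\<lambda>x. poly q x * jacobi_weight \<alpha> \<beta> x)"
proof -
  have "bounded (poly q ` {-1..1})"
    by (intro compact_imp_bounded compact_continuous_image continuous_on_poly) auto
  then obtain B where "\<forall>x\<in>{-1..1}. \<bar>poly q x\<bar> \<le> B" by (auto simp: bounded_iff)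
  then have B: "\<And>x. x \<in> {-1..1} \<Longrightarrow> \<bar>poly q x\<bar> \<le> B" by blast
  have [measurable]: "poly q \<in> borel_measurable borel"
    by (intro borel_measurable_continuous_onI continuous_on_poly) auto
  have "integrable lborel (\<lambda>x. indicator {-1<..<1} x *\<^sub>R jacobi_weight \<alpha> \<beta> x)"
    using set_integrable_jacobi_weight[OF assms] unfolding set_integrable_def .
  then have i: "integrable lborel (\<lambda>x. B * (indicator {-1<..<1} x *\<^sub>R jacobi_weight \<alpha> \<beta> x))"
    by (rule integrable_mult_right)
  show ?thesis unfolding set_integrable_def
  proof (rule Bochner_Integration.integrable_bound[OF i])
    show "(\<lambda>x. indicator {-1<..<1} x *\<^sub>R (poly q x * jacobi_weight \<alpha> \<beta> x)) \<in> borel_measurable lborel"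
      unfolding jacobi_weight_def by measurable
    show "AE x in lborel. norm (indicator {-1<..<1} x *\<^sub>R (poly q x * jacobi_weight \<alpha> \<beta> x))
            \<le> norm (B * (indicator {-1<..<1} x *\<^sub>R jacobi_weight \<alpha> \<beta> x))"
    proof (intro AE_I2)
      fix x :: real
      show "norm (indicator {-1<..<1} x *\<^sub>R (poly q x * jacobi_weight \<alpha> \<beta> x))
            \<le> norm (B * (indicator {-1<..<1} x *\<^sub>R jacobi_weight \<alpha> \<beta> x))"
        using B[of x] by (auto simp: indicator_def abs_mult intro!: mult_right_mono)
    qed
  qed
qed

lemma jacobi_integral_add:
  assumes "\<alpha> > -1" "\<beta> > -1"
  shows "jacobi_integral \<alpha> \<beta> (p + q) = jacobi_integral \<alpha> \<beta> p + jacobi_integral \<alpha> \<beta> q"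
  unfolding jacobi_integral_def poly_add distrib_right
  by (intro set_integral_add set_integrable_poly_jacobi_weight assms)

lemma jacobi_integral_smult:
  "jacobi_integral \<alpha> \<beta> (smult c p) = c * jacobi_integral \<alpha> \<beta> p"
  unfolding jacobi_integral_def by (simp add: mult.assoc)

lemma jacobi_integral_0 [simp]: "jacobi_integral \<alpha> \<beta> 0 = 0"
  by (simp add: jacobi_integral_def)

lemma jacobi_integral_diff:
  assumes "\<alpha> > -1" "\<beta> > -1"
  shows "jacobi_integral \<alpha> \<beta> (p - q) = jacobi_integral \<alpha> \<beta> p - jacobi_integral \<alpha> \<beta> q"
  using jacobi_integral_add[OF assms, of "p - q" q] by simp

lemma jacobi_integral_eq_integral:
  assumes "\<alpha> > -1" "\<beta> > -1"
  shows "jacobi_integral \<alpha> \<beta> q = integral {-1..1} (\<lambda>x. poly q x * jacobi_weight \<alpha> \<beta> x)"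
  unfolding jacobi_integral_def
  using set_borel_integral_eq_integral(2)[OF set_integrable_poly_jacobi_weight[OF assms, of q]]
  by (simp add: integral_open_interval_real)

text \<open>
  Green's formula: the difference of the two integrands is the derivative of
  \<open>(1 - x) powr (\<alpha> + 1) * (1 + x) powr (\<beta> + 1) * (p q' - q p')\<close>, which vanishes at both endpoints as
  \<open>\<alpha>, \<beta> > -1\<close>.
\<close>

lemma jacobi_op_symmetric:
  assumes "\<alpha> > -1" "\<beta> > -1"
  shows "jacobi_integral \<alpha> \<beta> (p * jacobi_op \<alpha> \<beta> q) = jacobi_integral \<alpha> \<beta> (q * jacobi_op \<alpha> \<beta> p)"
proof -
  define F where "F x = (1 - x) powr (\<alpha> + 1) * (1 + x) powr (\<beta> + 1) *
      (poly p x * poly (pderiv q) x - poly q x * poly (pderiv p) x)" for x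
  let ?r = "p * jacobi_op \<alpha> \<beta> q - q * jacobi_op \<alpha> \<beta> p"
  have cont: "continuous_on {-1..1} F"
    unfolding F_def using assms
    by (intro continuous_intros continuous_on_powr') auto
  have deriv: "(F has_vector_derivative poly ?r x * jacobi_weight \<alpha> \<beta> x) (at x)"
    if "x \<in> {-1<..<1}" for x
  proof -
    have x: "1 - x > 0" "1 + x > 0" using that by auto
    have a: "(1 - x) powr (\<alpha> + 1) = (1 - x) * (1 - x) powr \<alpha>"
            "(1 + x) powr (\<beta> + 1) = (1 + x) * (1 + x) powr \<beta>"
      using x by (simp_all add: powr_add)
    have d1: "((\<lambda>x. (1 - x) powr (\<alpha> + 1)) has_real_derivative - (\<alpha> + 1) * (1 - x) powr \<alpha>) (at x)"
      using x(1) by (auto intro!: derivative_eq_intros simp: left_diff_distrib distrib_right)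
    have d2: "((\<lambda>x. (1 + x) powr (\<beta> + 1)) has_real_derivative (\<beta> + 1) * (1 + x) powr \<beta>) (at x)"
      using x(2) by (auto intro!: derivative_eq_intros)
    define P0 P1 P2 Q0 Q1 Q2 A B where "P0 = poly p x" "P1 = poly (pderiv p) x" "P2 = poly (pderiv (pderiv p)) x"
      "Q0 = poly q x" "Q1 = poly (pderiv q) x" "Q2 = poly (pderiv (pderiv q)) x"
      "A = (1 - x) powr \<alpha>" "B = (1 + x) powr \<beta>"
    note vals = this
    have d3: "((\<lambda>x. poly p x * poly (pderiv q) x - poly q x * poly (pderiv p) x) has_real_derivative
        P0 * Q2 - Q0 * P2) (at x)"
      unfolding vals by (auto intro!: derivative_eq_intros)
    have val: "poly ?r x * jacobi_weight \<alpha> \<beta> x =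
        (P0 * ((1 - x * x) * Q2 + (\<beta> - \<alpha> - (\<alpha> + \<beta> + 2) * x) * Q1)
       - Q0 * ((1 - x * x) * P2 + (\<beta> - \<alpha> - (\<alpha> + \<beta> + 2) * x) * P1)) * (A * B)"
      unfolding vals jacobi_op_def jacobi_weight_def
      by (simp add: algebra_simps)
    have "(F has_real_derivative
       (- (\<alpha> + 1) * A * ((1 + x) * B) + (1 - x) * A * ((\<beta> + 1) * B)) * (P0 * Q1 - Q0 * P1)
       + (1 - x) * A * ((1 + x) * B) * (P0 * Q2 - Q0 * P2)) (at x)"
      unfolding F_def
      by (rule DERIV_cong[OF DERIV_mult[OF DERIV_mult[OF d1 d2] d3]])
         (simp only: a vals, simp add: algebra_simps)
    also have "(- (\<alpha> + 1) * A * ((1 + x) * B) + (1 - x) * A * ((\<beta> + 1) * B)) * (P0 * Q1 - Q0 * P1)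
       + (1 - x) * A * ((1 + x) * B) * (P0 * Q2 - Q0 * P2) = poly ?r x * jacobi_weight \<alpha> \<beta> x"
      unfolding val by algebra
    finally have "(F has_real_derivative poly ?r x * jacobi_weight \<alpha> \<beta> x) (at x)" .
    then show ?thesis by (simp add: has_real_derivative_iff_has_vector_derivative)
  qed
  have "((\<lambda>x. poly ?r x * jacobi_weight \<alpha> \<beta> x) has_integral F 1 - F (-1)) {-1..1}"
    using fundamental_theorem_of_calculus_interior[OF _ cont deriv] by simp
  moreover have "F 1 = 0" "F (-1) = 0" using assms by (auto simp: F_def)
  ultimately have "jacobi_integral \<alpha> \<beta> ?r = 0"
    unfolding jacobi_integral_eq_integral[OF assms] by (simp add: integral_unique)
  then show ?thesis by (simp add: jacobi_integral_diff[OF assms])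
qed

text \<open>
  Moving the operator from the power \<open>(1 - x)\<^sup>m\<close> to the eigenvector multiplies the integral by
  different eigenvalues on the two sides, up to the integral for \<open>m - 1\<close>, which is 0 by induction.
\<close>

lemma jacobi_series_orthogonal_power:
  assumes "\<alpha> > -1" "\<beta> > -1" "m < n"
  shows "jacobi_integral \<alpha> \<beta> (jacobi_series \<alpha> \<beta> n * [:1, -1:] ^ m) = 0"
  using assms(3)
proof (induction m)
  case 0
  let ?P = "jacobi_series \<alpha> \<beta> n"
  have "jacobi_op \<alpha> \<beta> 1 = 0" by (simp add: jacobi_op_def)
  then have "- jacobi_eigenvalue \<alpha> \<beta> n * jacobi_integral \<alpha> \<beta> ?P = 0"
    using jacobi_op_symmetric[OF assms(1,2), of ?P 1]
    by (simp add: jacobi_op_series[OF assms(1)] jacobi_integral_smult flip: smult_minus_left)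
  moreover have "jacobi_eigenvalue \<alpha> \<beta> n > 0"
    using jacobi_eigenvalue_less[OF assms(1,2) 0] by (simp add: jacobi_eigenvalue_def)
  ultimately show ?case by simp
next
  case (Suc m)
  let ?P = "jacobi_series \<alpha> \<beta> n" and ?t = "[:1, -1:] :: real poly"
  let ?l = "jacobi_eigenvalue \<alpha> \<beta>"
  have "jacobi_integral \<alpha> \<beta> (?P * jacobi_op \<alpha> \<beta> (?t ^ Suc m)) =
        - ?l (Suc m) * jacobi_integral \<alpha> \<beta> (?P * ?t ^ Suc m)"
    using Suc by (simp add: jacobi_op_power jacobi_integral_diff[OF assms(1,2)] jacobi_integral_smult
        right_diff_distrib del: power_Suc)
  moreover have "jacobi_integral \<alpha> \<beta> (?P * jacobi_op \<alpha> \<beta> (?t ^ Suc m)) =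
        - ?l n * jacobi_integral \<alpha> \<beta> (?P * ?t ^ Suc m)"
    by (subst jacobi_op_symmetric[OF assms(1,2)])
       (simp only: jacobi_op_series[OF assms(1)] mult_smult_right jacobi_integral_smult mult.commute[of ?P])
  moreover have "?l (Suc m) < ?l n" using jacobi_eigenvalue_less[OF assms(1,2)] Suc by simp
  ultimately show ?case by (metis mult_right_cancel neg_equal_iff_equal less_irrefl)
qed

lemma jacobi_series_orthogonal:
  assumes "\<alpha> > -1" "\<beta> > -1" "degree q < n"
  shows "jacobi_integral \<alpha> \<beta> (jacobi_series \<alpha> \<beta> n * q) = 0"
proof -
  let ?P = "jacobi_series \<alpha> \<beta> n"
  have "jacobi_integral \<alpha> \<beta> (?P * q) = 0" if "\<forall>i\<ge>k. coeff q i = 0" "k \<le> n" for k q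
    using that
  proof (induction k arbitrary: q)
    case 0
    then have "q = 0" by (simp add: poly_eq_iff)
    then show ?case by simp
  next
    case (Suc k)
    define c where "c = coeff q k * (-1) ^ k"
    define r where "r = q - smult c ([:1, -1:] ^ k)"
    have "coeff r i = 0" if "i \<ge> k" for i
    proof (cases "i = k")
      case True
      then show ?thesis
        by (simp add: r_def c_def coeff_one_minus_power mult.assoc flip: power_mult_distrib)
    next
      case False
      then show ?thesis using that Suc.prems by (simp add: r_def coeff_one_minus_power)
    qed
    then have "jacobi_integral \<alpha> \<beta> (?P * r) = 0" using Suc by simp
    moreover have "?P * q = ?P * r + smult c (?P * [:1, -1:] ^ k)"
      by (simp add: r_def algebra_simps)
    moreover have "jacobi_integral \<alpha> \<beta> (?P * [:1, -1:] ^ k) = 0"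
      using jacobi_series_orthogonal_power[OF assms(1,2)] Suc.prems(2) by simp
    ultimately show ?case
      by (simp only: jacobi_integral_add[OF assms(1,2)] jacobi_integral_smult mult_zero_right add_0)
  qed
  from this[of "Suc (degree q)" q] show ?thesis using assms(3) by (simp add: coeff_eq_0)
qed

lemma jacobi_integral_nonneg_eq_0:
  assumes "\<alpha> > -1" "\<beta> > -1" and nn: "\<And>x. -1 < x \<Longrightarrow> x < 1 \<Longrightarrow> 0 \<le> poly q x"
    and "jacobi_integral \<alpha> \<beta> q = 0"
  shows "q = 0"
proof (rule ccontr)
  assume "q \<noteq> 0"
  let ?f = "\<lambda>x. indicator {-1<..<1} x *\<^sub>R (poly q x * jacobi_weight \<alpha> \<beta> x)"
  have "AE x in lborel. ?f x = 0"
  proof (subst integral_nonneg_eq_0_iff_AE[symmetric])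
    show "integrable lborel ?f"
      using set_integrable_poly_jacobi_weight[OF assms(1,2)] unfolding set_integrable_def .
    show "AE x in lborel. 0 \<le> ?f x"
      using nn by (intro AE_I2) (auto simp: indicator_def jacobi_weight_def)
    show "integral\<^sup>L lborel ?f = 0"
      using assms(4) unfolding jacobi_integral_def set_lebesgue_integral_def .
  qed
  moreover have "AE x in lborel. x \<notin> {x. poly q x = 0}"
    using \<open>q \<noteq> 0\<close> by (intro AE_not_in) (simp add: poly_roots_finite finite_imp_null_set_lborel)
  ultimately have "AE x in lborel. x \<notin> {-1<..<1::real}"
  proof eventually_elim
    case (elim x)
    then show ?case by (auto simp: jacobi_weight_def indicator_def)
  qed
  then have "emeasure lborel {-1<..<1::real} = 0"
    by (subst (asm) AE_iff_measurable[of "{-1<..<1}"]) auto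
  then show False by simp
qed

lemma is_jacobi_poly_iff:
  "is_jacobi_poly \<alpha> \<beta> n p \<longleftrightarrow> degree p = n \<and>
     (\<forall>q. degree q < n \<longrightarrow> jacobi_integral \<alpha> \<beta> (p * q) = 0) \<and> poly p 1 = (real n + \<alpha>) gchoose n"
  by (simp add: is_jacobi_poly_def jacobi_integral_def jacobi_weight_def)

lemma is_jacobi_poly_series:
  "\<alpha> > -1 \<Longrightarrow> \<beta> > -1 \<Longrightarrow> is_jacobi_poly \<alpha> \<beta> n (jacobi_series \<alpha> \<beta> n)"
  by (simp add: is_jacobi_poly_iff degree_jacobi_series jacobi_series_orthogonal poly_jacobi_series_1)

text \<open>
  The combination \<open>r\<close> of two candidates that cancels their leading terms has degree less than \<open>n\<close>. It is
  therefore orthogonal to both, hence to itself. So the candidates are proportional, and their common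
  nonzero value at 1 fixes the factor.
\<close>

lemma is_jacobi_poly_unique:
  assumes ab: "\<alpha> > -1" "\<beta> > -1" and "n \<ge> 1"
    and p: "is_jacobi_poly \<alpha> \<beta> n p" and q: "is_jacobi_poly \<alpha> \<beta> n q"
  shows "p = q"
proof -
  define r where "r = smult (lead_coeff q) p - smult (lead_coeff p) q"
  have "degree r < n"
  proof (rule degree_lessI)
    show "r \<noteq> 0 \<or> 0 < n" using \<open>n \<ge> 1\<close> by simp
    show "\<forall>k\<ge>n. coeff r k = 0"
    proof (intro allI impI)
      fix k assume "n \<le> k"
      then show "coeff r k = 0"
        using p q by (cases "k = n") (auto simp: r_def is_jacobi_poly_iff coeff_eq_0)
    qed
  qed
  then have "jacobi_integral \<alpha> \<beta> (p * r) = 0" "jacobi_integral \<alpha> \<beta> (q * r) = 0"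
    using p q by (auto simp: is_jacobi_poly_iff)
  moreover have "r * r = smult (lead_coeff q) (p * r) - smult (lead_coeff p) (q * r)"
    by (subst (1) r_def) (simp add: left_diff_distrib)
  ultimately have "jacobi_integral \<alpha> \<beta> (r * r) = 0"
    by (simp add: jacobi_integral_diff[OF ab] jacobi_integral_smult)
  then have "r * r = 0" by (intro jacobi_integral_nonneg_eq_0[OF ab]) auto
  then have eq: "smult (lead_coeff q) p = smult (lead_coeff p) q" by (simp add: r_def)
  then have "lead_coeff q * poly p 1 = lead_coeff p * poly q 1" by (metis poly_smult)
  then have "lead_coeff q = lead_coeff p"
    using p q gchoose_pos[OF ab(1), of n] by (simp add: is_jacobi_poly_iff)
  moreover have "lead_coeff p \<noteq> 0" using p \<open>n \<ge> 1\<close> by (auto simp: is_jacobi_poly_iff)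
  ultimately show "p = q" using eq by (metis smult_cancel smult_eq_iff)
qed

lemma jacobi_poly_eq_series:
  assumes "\<alpha> > -1" "\<beta> > -1" "n \<ge> 1"
  shows "jacobi_poly \<alpha> \<beta> n = jacobi_series \<alpha> \<beta> n"
  unfolding jacobi_poly_def
  using is_jacobi_poly_series[OF assms(1,2)] is_jacobi_poly_unique[OF assms _ is_jacobi_poly_series[OF assms(1,2)]]
  by (rule the_equality)

text \<open>
  One linear factor for each zero of odd order in the interval makes the product nonnegative.
\<close>

lemma poly_sign_correction:
  fixes p :: "real poly"
  assumes "p \<noteq> 0"
  shows "\<exists>q. q \<noteq> 0 \<and> degree q \<le> card {x. a < x \<and> x < b \<and> poly p x = 0} \<and>
           (\<forall>x. a < x \<longrightarrow> x < b \<longrightarrow> 0 \<le> poly (p * q) x)"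
  using assms
proof (induction "card {x. a < x \<and> x < b \<and> poly p x = 0}" arbitrary: p rule: less_induct)
  case less
  let ?Z = "\<lambda>p. {x. a < x \<and> x < b \<and> poly p x = 0}"
  show ?case
  proof (cases "?Z p = {}")
    case True
    have "(\<forall>x. a < x \<and> x < b \<longrightarrow> poly p x > 0) \<or> (\<forall>x. a < x \<and> x < b \<longrightarrow> poly p x < 0)"
      using True by (intro nonzero_imp_constant_sign) (auto intro: continuous_intros)
    then show ?thesis
    proof
      assume "\<forall>x. a < x \<and> x < b \<longrightarrow> poly p x > 0"
      then show ?thesis by (intro exI[of _ 1]) (auto intro: less_imp_le)
    next
      assume "\<forall>x. a < x \<and> x < b \<longrightarrow> poly p x < 0"
      then show ?thesis by (intro exI[of _ "-1"]) (auto intro: less_imp_le)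
    qed
  next
    case False
    then obtain r where r: "r \<in> ?Z p" by auto
    obtain p1 where p1: "p = [:-r, 1:] ^ order r p * p1" "\<not> [:-r, 1:] dvd p1"
      using order_decomp[OF less.prems] by blast
    have ord: "order r p > 0" using r less.prems by (simp add: order_root)
    have "poly p1 r \<noteq> 0" using p1(2) by (simp add: poly_eq_0_iff_dvd)
    moreover have val: "poly p x = (x - r) ^ order r p * poly p1 x" for x
      by (subst p1(1)) simp
    ultimately have Z: "?Z p1 = ?Z p - {r}" using ord by auto
    have fin: "finite (?Z p)"
      by (rule finite_subset[OF _ poly_roots_finite[OF less.prems]]) auto
    have card: "card (?Z p) = Suc (card (?Z p1))"
      unfolding Z using fin r by (rule card.remove)
    have "p1 \<noteq> 0" using p1(2) by auto
    with less.hyps[of p1] card obtain q1 where q1: "q1 \<noteq> 0" "degree q1 \<le> card (?Z p1)"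
      "\<And>x. a < x \<Longrightarrow> x < b \<Longrightarrow> 0 \<le> poly (p1 * q1) x" by auto
    \<comment> \<open>a zero of even order needs no correction\<close>
    define e where "e = order r p mod 2"
    define q where "q = [:-r, 1:] ^ e * q1"
    have "degree q \<le> Suc (card (?Z p1))"
      using q1(1,2) by (auto simp: q_def degree_mult_eq degree_power_eq e_def)
    moreover have "q \<noteq> 0" using q1(1) by (simp add: q_def)
    moreover have "0 \<le> poly (p * q) x" if "a < x" "x < b" for x
    proof -
      have "poly (p * q) x = (x - r) ^ (order r p + e) * poly (p1 * q1) x"
        by (simp add: val q_def power_add)
      moreover have "even (order r p + e)" by (simp add: e_def mod2_eq_if)
      ultimately show ?thesis using q1(3)[OF that] by (simp add: zero_le_even_power)
    qed
    ultimately show ?thesis using card by auto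
  qed
qed

text \<open>
  With fewer than \<open>n\<close> zeros, the sign-correcting factor would have degree less than \<open>n\<close>, so that the
  product would be nonnegative and have integral 0.
\<close>

lemma card_jacobi_zeros:
  assumes "\<alpha> > -1" "\<beta> > -1"
  shows "n \<le> card {x. -1 < x \<and> x < 1 \<and> poly (jacobi_series \<alpha> \<beta> n) x = 0}"
proof (rule ccontr)
  let ?P = "jacobi_series \<alpha> \<beta> n"
  assume *: "\<not> ?thesis"
  have "?P \<noteq> 0" using poly_jacobi_series_1[of \<alpha> \<beta> n] gchoose_pos[OF assms(1), of n] by auto
  with poly_sign_correction[of ?P "-1" 1] obtain q where q: "q \<noteq> 0"
    "degree q \<le> card {x. -1 < x \<and> x < 1 \<and> poly ?P x = 0}"
    "\<And>x. -1 < x \<Longrightarrow> x < 1 \<Longrightarrow> 0 \<le> poly (?P * q) x" by auto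
  have "jacobi_integral \<alpha> \<beta> (?P * q) = 0"
    using * q(2) by (intro jacobi_series_orthogonal assms) simp
  then have "?P * q = 0" by (intro jacobi_integral_nonneg_eq_0[OF assms] q(3))
  then show False using \<open>?P \<noteq> 0\<close> q(1) by simp
qed

lemma is_kth_least_jacobi_theta:
  assumes "\<alpha> > -1" "\<beta> > -1" "n \<ge> 1" "1 \<le> k" "k \<le> n"
  shows "is_kth_least {\<theta>. 0 < \<theta> \<and> \<theta> < pi \<and> poly (jacobi_series \<alpha> \<beta> n) (cos \<theta>) = 0} k (jacobi_theta \<alpha> \<beta> n k)"
proof -
  let ?P = "jacobi_series \<alpha> \<beta> n"
  let ?X = "{x. -1 < x \<and> x < 1 \<and> poly ?P x = 0}"
  let ?S = "{\<theta>. 0 < \<theta> \<and> \<theta> < pi \<and> poly ?P (cos \<theta>) = 0}"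
  have "?P \<noteq> 0" using poly_jacobi_series_1[of \<alpha> \<beta> n] gchoose_pos[OF assms(1), of n] by auto
  then have fin: "finite ?X" by (intro finite_subset[OF _ poly_roots_finite]) auto
  have S: "?S = arccos ` ?X"
  proof (intro set_eqI iffI)
    fix t assume t: "t \<in> ?S"
    then have "cos t < cos 0" "cos pi < cos t" by (intro cos_monotone_0_pi; simp)+
    with t show "t \<in> arccos ` ?X" by (intro image_eqI[of _ _ "cos t"]) (auto simp: arccos_cos)
  qed (auto simp: arccos_lt_bounded)
  have inj: "inj_on arccos ?X" by (rule inj_on_inverseI[of _ cos]) (simp add: cos_arccos)
  have "is_kth_least ?S k (kth_least ?S k)"
  proof (rule is_kth_least_kth_least[OF _ \<open>1 \<le> k\<close>])
    show "finite ?S" unfolding S using fin by simp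
    then show "finite {y \<in> ?S. y \<le> x}" for x by (rule rev_finite_subset) auto
    show "k \<le> card ?S"
      unfolding S card_image[OF inj] using card_jacobi_zeros[OF assms(1,2), of n] assms(5) by simp
  qed auto
  then show ?thesis by (simp only: jacobi_theta_def jacobi_poly_eq_series[OF assms(1-3)])
qed

section \<open>Bessel functions: differential equation and zeros\<close>

definition bessel_coeff :: "real \<Rightarrow> nat \<Rightarrow> real" where
  "bessel_coeff \<alpha> m = (-1) ^ m / fact m * rGamma (real m + \<alpha> + 1) / 4 ^ m"

lemma bessel_coeff_Suc:
  "4 * (real (Suc m) * (real (Suc m) + \<alpha>)) * bessel_coeff \<alpha> (Suc m) = - bessel_coeff \<alpha> m"
proof -
  define s where "s = real (Suc m)"
  have rG: "rGamma (real m + \<alpha> + 1) = (s + \<alpha>) * rGamma (s + \<alpha> + 1)"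
    using rGamma_plus1[of "real m + \<alpha> + 1"] by (simp add: s_def algebra_simps)
  have "s \<noteq> 0" "fact (Suc m) = s * fact m" by (simp_all add: s_def)
  then show ?thesis
    unfolding bessel_coeff_def rG s_def[symmetric] by (simp add: field_simps)
qed

lemma summable_bessel_coeff:
  fixes z :: "'a :: {real_normed_field, banach}"
  assumes "\<alpha> > -1"
  shows "summable (\<lambda>m. of_real (bessel_coeff \<alpha> m) * z ^ m)"
proof (rule summable_ratio_test)
  fix m assume m: "nat \<lceil>norm z\<rceil> + 1 \<le> m"
  then have z: "norm z \<le> real m" "1 \<le> real m" by linarith+
  define X where "X = real (Suc m) * (real (Suc m) + \<alpha>)"
  have "real m * 1 \<le> X"
    unfolding X_def using assms z by (intro mult_mono) auto
  then have X: "norm z \<le> X" "X > 0" using z by auto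
  have b: "bessel_coeff \<alpha> (Suc m) = - bessel_coeff \<alpha> m / (4 * X)"
    using bessel_coeff_Suc[of m \<alpha>] X(2) unfolding X_def[symmetric] by (simp add: field_simps)
  have "norm (of_real (bessel_coeff \<alpha> (Suc m)) * z ^ Suc m) =
      (norm z / (4 * X)) * norm (of_real (bessel_coeff \<alpha> m) * z ^ m)"
    unfolding b norm_mult norm_of_real norm_power using X(2) by (simp add: abs_mult)
  also have "norm z / (4 * X) \<le> 1 / 2"
    using X by (simp add: divide_le_eq)
  then have "(norm z / (4 * X)) * norm (of_real (bessel_coeff \<alpha> m) * z ^ m)
      \<le> 1 / 2 * norm (of_real (bessel_coeff \<alpha> m) * z ^ m)"
    by (rule mult_right_mono) simp
  finally show "norm (of_real (bessel_coeff \<alpha> (Suc m)) * z ^ Suc m)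
      \<le> 1 / 2 * norm (of_real (bessel_coeff \<alpha> m) * z ^ m)" .
qed simp

text \<open>
  \<open>J\<^sub>\<alpha>(x) = (x/2) powr \<alpha> * G(x\<^sup>2)\<close> with an entire function \<open>G\<close>. Working with \<open>G\<close> separates the
  singular power from the analytic part. Its first two derivatives are given by the differentiated
  series.
\<close>

definition bessel_entire :: "real \<Rightarrow> real \<Rightarrow> real" where
  "bessel_entire \<alpha> x = (\<Sum>m. bessel_coeff \<alpha> m * x ^ m)"

definition bessel_entire' :: "real \<Rightarrow> real \<Rightarrow> real" where
  "bessel_entire' \<alpha> x = (\<Sum>m. diffs (bessel_coeff \<alpha>) m * x ^ m)"

definition bessel_entire'' :: "real \<Rightarrow> real \<Rightarrow> real" where
  "bessel_entire'' \<alpha> x = (\<Sum>m. diffs (diffs (bessel_coeff \<alpha>)) m * x ^ m)"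

lemma summable_bessel_real:
  assumes "\<alpha> > -1"
  shows "summable (\<lambda>m. bessel_coeff \<alpha> m * (x::real) ^ m)"
    and "summable (\<lambda>m. diffs (bessel_coeff \<alpha>) m * (x::real) ^ m)"
    and "summable (\<lambda>m. diffs (diffs (bessel_coeff \<alpha>)) m * (x::real) ^ m)"
proof -
  show 1: "summable (\<lambda>m. bessel_coeff \<alpha> m * x ^ m)" for x
    using summable_bessel_coeff[OF assms, of x] by simp
  show 2: "summable (\<lambda>m. diffs (bessel_coeff \<alpha>) m * x ^ m)" for x
    by (rule termdiff_converges_all) (rule 1)
  show "summable (\<lambda>m. diffs (diffs (bessel_coeff \<alpha>)) m * x ^ m)"
    by (rule termdiff_converges_all) (rule 2)
qed

lemma bessel_entire_deriv:
  assumes "\<alpha> > -1"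
  shows "(bessel_entire \<alpha> has_real_derivative bessel_entire' \<alpha> x) (at x)"
    and "(bessel_entire' \<alpha> has_real_derivative bessel_entire'' \<alpha> x) (at x)"
  unfolding bessel_entire_def[abs_def] bessel_entire'_def[abs_def] bessel_entire''_def
  by (rule termdiffs_strong_converges_everywhere summable_bessel_real assms)+

lemma bessel_entire_ode:
  assumes "\<alpha> > -1"
  shows "x * bessel_entire'' \<alpha> x + (\<alpha> + 1) * bessel_entire' \<alpha> x + bessel_entire \<alpha> x / 4 = 0"
proof -
  let ?b = "bessel_coeff \<alpha>"
  note s = summable_bessel_real[OF assms]
  have "(\<lambda>m. real m * diffs ?b m * x ^ (m - Suc 0)) sums bessel_entire'' \<alpha> x"
    unfolding bessel_entire''_def by (rule diffs_equiv[OF s(3)])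
  from sums_mult[OF this, of x]
  have "(\<lambda>m. real m * diffs ?b m * x ^ m) sums (x * bessel_entire'' \<alpha> x)"
  proof (rule sums_cong[THEN iffD1, rotated])
    fix m show "x * (real m * diffs ?b m * x ^ (m - Suc 0)) = real m * diffs ?b m * x ^ m"
      by (cases m) auto
  qed
  moreover have "(\<lambda>m. (\<alpha> + 1) * (diffs ?b m * x ^ m)) sums ((\<alpha> + 1) * bessel_entire' \<alpha> x)"
    unfolding bessel_entire'_def by (intro sums_mult summable_sums s(2))
  moreover have "(\<lambda>m. ?b m * x ^ m / 4) sums (bessel_entire \<alpha> x / 4)"
    unfolding bessel_entire_def by (intro sums_divide summable_sums s(1))
  ultimately have "(\<lambda>m. real m * diffs ?b m * x ^ m + (\<alpha> + 1) * (diffs ?b m * x ^ m) + ?b m * x ^ m / 4)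
     sums (x * bessel_entire'' \<alpha> x + (\<alpha> + 1) * bessel_entire' \<alpha> x + bessel_entire \<alpha> x / 4)"
    by (intro sums_add)
  moreover have "real m * diffs ?b m * x ^ m + (\<alpha> + 1) * (diffs ?b m * x ^ m) + ?b m * x ^ m / 4 = 0" for m
  proof -
    have "real m * diffs ?b m * x ^ m + (\<alpha> + 1) * (diffs ?b m * x ^ m) + ?b m * x ^ m / 4 =
       ((real (Suc m) + \<alpha>) * (real (Suc m) * ?b (Suc m)) + ?b m / 4) * x ^ m"
      by (simp add: diffs_def algebra_simps)
    also have "(real (Suc m) + \<alpha>) * (real (Suc m) * ?b (Suc m)) =
        4 * (real (Suc m) * (real (Suc m) + \<alpha>)) * ?b (Suc m) / 4"
      by (simp only: mult_ac)
    finally show ?thesis unfolding bessel_coeff_Suc by simp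
  qed
  ultimately have "(\<lambda>m. 0) sums (x * bessel_entire'' \<alpha> x + (\<alpha> + 1) * bessel_entire' \<alpha> x + bessel_entire \<alpha> x / 4)"
    by simp
  then show ?thesis using sums_unique2 sums_zero by blast
qed

lemma bessel_entire_0: "\<alpha> > -1 \<Longrightarrow> bessel_entire \<alpha> 0 > 0"
  unfolding bessel_entire_def powser_zero
  by (simp add: bessel_coeff_def rGamma_inverse_Gamma Gamma_real_pos)

lemma bessel_J_eq_bessel_entire:
  assumes "\<alpha> > -1" "x > 0"
  shows "bessel_J \<alpha> x = (x / 2) powr \<alpha> * bessel_entire \<alpha> (x\<^sup>2)"
proof -
  have "(-1) ^ m / fact m * rGamma (real m + \<alpha> + 1) * (x / 2) powr (2 * real m + \<alpha>) =
        (x / 2) powr \<alpha> * (bessel_coeff \<alpha> m * (x\<^sup>2) ^ m)" for m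
  proof -
    have "(x / 2) powr (2 * real m) = (x / 2) ^ (2 * m)"
      using assms(2) powr_realpow[of "x / 2" "2 * m"] by simp
    also have "\<dots> = (x\<^sup>2) ^ m / 4 ^ m" by (simp add: power_mult power_divide)
    finally show ?thesis by (simp add: powr_add bessel_coeff_def)
  qed
  then show ?thesis unfolding bessel_J_def bessel_entire_def
    by (simp add: suminf_mult[OF summable_bessel_real(1)[OF assms(1)]])
qed

text \<open>
  The same power series defines an entire function of a complex variable, whose zeros are isolated
  unless it is constant, and then it has none because its value at 0 is positive.
\<close>

lemma finite_bessel_entire_zeros:
  assumes "\<alpha> > -1"
  shows "finite {x. \<bar>x\<bar> \<le> X \<and> bessel_entire \<alpha> x = 0}"
proof -
  define b where "b m = (of_real (bessel_coeff \<alpha> m) :: complex)" for m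
  define H where "H z = (\<Sum>m. b m * z ^ m)" for z :: complex
  have s: "summable (\<lambda>m. b m * z ^ m)" for z
    unfolding b_def by (rule summable_bessel_coeff[OF assms])
  have "(H has_field_derivative (\<Sum>m. diffs b m * z ^ m)) (at z)" for z
    unfolding H_def[abs_def] by (rule termdiffs_strong_converges_everywhere[OF s])
  then have hol: "H holomorphic_on UNIV"
    by (auto simp: holomorphic_on_open)
  have HG: "H (of_real x) = of_real (bessel_entire \<alpha> x)" for x
    unfolding H_def b_def bessel_entire_def
    by (subst suminf_of_real[OF summable_bessel_real(1)[OF assms]]) simp
  show ?thesis
  proof (cases "H constant_on UNIV")
    case True
    then obtain y where "\<And>x. H x = y" by (auto simp: constant_on_def)
    then have "bessel_entire \<alpha> x = bessel_entire \<alpha> 0" for x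
      using HG[of x] HG[of 0] by (metis of_real_eq_iff)
    then have "bessel_entire \<alpha> x \<noteq> 0" for x
      using bessel_entire_0[OF assms] by (metis less_irrefl)
    then show ?thesis by simp
  next
    case False
    then have "finite {z \<in> cball 0 X. H z = 0}"
      by (intro holomorphic_compact_finite_zeros[OF hol]) auto
    moreover have "of_real ` {x. \<bar>x\<bar> \<le> X \<and> bessel_entire \<alpha> x = 0} \<subseteq> {z \<in> cball 0 X. H z = 0}"
      using HG by auto
    ultimately have "finite ((of_real :: real \<Rightarrow> complex) ` {x. \<bar>x\<bar> \<le> X \<and> bessel_entire \<alpha> x = 0})"
      by (rule rev_finite_subset)
    then show ?thesis by (rule finite_imageD) (auto simp: inj_on_def)
  qed
qed

text \<open>
  This is \<open>\<surd>x J\<^sub>\<alpha>(c x)\<close> up to a positive constant factor.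
\<close>

definition bessel_solution :: "real \<Rightarrow> real \<Rightarrow> real \<Rightarrow> real" where
  "bessel_solution \<alpha> c x = x powr (\<alpha> + 1/2) * bessel_entire \<alpha> (c\<^sup>2 * x\<^sup>2)"

definition bessel_solution' :: "real \<Rightarrow> real \<Rightarrow> real \<Rightarrow> real" where
  "bessel_solution' \<alpha> c x = x powr (\<alpha> + 1/2) *
     (2 * c\<^sup>2 * x * bessel_entire' \<alpha> (c\<^sup>2 * x\<^sup>2) + (2 * \<alpha> + 1) / x / 2 * bessel_entire \<alpha> (c\<^sup>2 * x\<^sup>2))"

lemma bessel_solution_solves:
  assumes "\<alpha> > -1"
  shows "solves_on {0<..} (\<lambda>x. c\<^sup>2 + (1/4 - \<alpha>\<^sup>2) / x\<^sup>2) (bessel_solution \<alpha> c) (bessel_solution' \<alpha> c)"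
proof -
  let ?U' = "\<lambda>x. 2 * c\<^sup>2 * x * bessel_entire' \<alpha> (c\<^sup>2 * x\<^sup>2)"
  have inner: "((\<lambda>x. c\<^sup>2 * x\<^sup>2) has_real_derivative 2 * c\<^sup>2 * x) (at x)" for x
    by (auto intro!: derivative_eq_intros)
  note d = DERIV_chain2[where g = "\<lambda>x. c\<^sup>2 * x\<^sup>2", OF bessel_entire_deriv(1)[OF assms] inner]
           DERIV_chain2[where g = "\<lambda>x. c\<^sup>2 * x\<^sup>2", OF bessel_entire_deriv(2)[OF assms] inner]
  have "solves_on {0<..} (\<lambda>x. c\<^sup>2 - ((2 * \<alpha> + 1) / x)\<^sup>2 / 4 - (- (2 * \<alpha> + 1) / x\<^sup>2) / 2)
     (\<lambda>x. x powr (\<alpha> + 1/2) * bessel_entire \<alpha> (c\<^sup>2 * x\<^sup>2))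
     (\<lambda>x. x powr (\<alpha> + 1/2) * (?U' x + (2 * \<alpha> + 1) / x / 2 * bessel_entire \<alpha> (c\<^sup>2 * x\<^sup>2)))"
  proof (rule liouville_normal_form)
    fix x :: real assume "x \<in> {0<..}"
    then have x: "x > 0" by simp
    have e: "x powr (\<alpha> + 1/2 - 1) = x powr (\<alpha> + 1/2) / x"
      using x powr_diff[of x "\<alpha> + 1/2" 1] by simp
    have "(\<alpha> + 1/2) * (A / x) = A * ((2 * \<alpha> + 1) / x / 2)" for A
      using x by (simp add: field_simps)
    then show "((\<lambda>x. x powr (\<alpha> + 1/2)) has_real_derivative x powr (\<alpha> + 1/2) * ((2 * \<alpha> + 1) / x / 2)) (at x)"
      using has_real_derivative_powr[OF x, of "\<alpha> + 1/2"] unfolding e by simp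
    show "((\<lambda>x. (2 * \<alpha> + 1) / x) has_real_derivative - (2 * \<alpha> + 1) / x\<^sup>2) (at x)"
      using x by (auto intro!: derivative_eq_intros simp: power2_eq_square)
    show "((\<lambda>x. bessel_entire \<alpha> (c\<^sup>2 * x\<^sup>2)) has_real_derivative ?U' x) (at x)"
      by (rule DERIV_cong[OF d(1)]) simp
    have ode: "c\<^sup>2 * x\<^sup>2 * bessel_entire'' \<alpha> (c\<^sup>2 * x\<^sup>2) =
      - ((\<alpha> + 1) * bessel_entire' \<alpha> (c\<^sup>2 * x\<^sup>2) + bessel_entire \<alpha> (c\<^sup>2 * x\<^sup>2) / 4)"
      using bessel_entire_ode[OF assms, of "c\<^sup>2 * x\<^sup>2"] by simp
    have "(?U' has_real_derivative
        2 * c\<^sup>2 * bessel_entire' \<alpha> (c\<^sup>2 * x\<^sup>2) + 4 * c\<^sup>2 * (c\<^sup>2 * x\<^sup>2 * bessel_entire'' \<alpha> (c\<^sup>2 * x\<^sup>2))) (at x)"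
      by (rule derivative_eq_intros d(2) refl)+ (simp add: algebra_simps power2_eq_square)
    moreover have "(2 * \<alpha> + 1) / x * ?U' x = (2 * \<alpha> + 1) * (2 * c\<^sup>2 * bessel_entire' \<alpha> (c\<^sup>2 * x\<^sup>2))"
      using x by (simp add: field_simps)
    moreover have "2 * c\<^sup>2 * G + 4 * c\<^sup>2 * - ((\<alpha> + 1) * G + H / 4) =
        - ((2 * \<alpha> + 1) * (2 * c\<^sup>2 * G) + c\<^sup>2 * H)" for G H
      by (simp add: algebra_simps)
    ultimately show "(?U' has_real_derivative
        - ((2 * \<alpha> + 1) / x * ?U' x + c\<^sup>2 * bessel_entire \<alpha> (c\<^sup>2 * x\<^sup>2))) (at x)"
      unfolding ode by (simp only:)
  qed
  then have "solves_on {0<..} (\<lambda>x. c\<^sup>2 - ((2 * \<alpha> + 1) / x)\<^sup>2 / 4 - (- (2 * \<alpha> + 1) / x\<^sup>2) / 2)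
     (bessel_solution \<alpha> c) (bessel_solution' \<alpha> c)"
    unfolding bessel_solution_def[abs_def] bessel_solution'_def[abs_def] .
  then show ?thesis
    by (rule solves_on_cong) (simp add: field_simps power2_eq_square)
qed

lemma bessel_solution_eq_0_iff:
  assumes "\<alpha> > -1" "c > 0" "x > 0"
  shows "bessel_solution \<alpha> c x = 0 \<longleftrightarrow> bessel_J \<alpha> (c * x) = 0"
  using assms by (simp add: bessel_solution_def bessel_J_eq_bessel_entire power_mult_distrib)

text \<open>
  Far out the coefficient \<open>1 + (1/4 - \<alpha>\<^sup>2)/x\<^sup>2\<close> exceeds \<open>1/4\<close>, so the solution has a zero between any two
  consecutive zeros of \<open>sin ((x - p) / 2)\<close>.
\<close>

lemma bessel_J_zero_beyond:
  assumes "\<alpha> > -1"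
  shows "\<exists>x>X. 0 < x \<and> bessel_J \<alpha> x = 0"
proof -
  \<comment> \<open>beyond this point, 1 / 4 < 1 + (1 / 4 - \<alpha> ^ 2) / x ^ 2\<close>
  define a where "a = max X (2 * (\<bar>\<alpha>\<bar> + 1))"
  define p where "p = a + 1"
  define b where "b = p + 2 * pi"
  have a: "a \<ge> 2" "a \<ge> X" "a \<ge> 2 * (\<bar>\<alpha>\<bar> + 1)" by (auto simp: a_def)
  have "\<exists>z. p < z \<and> z < b \<and> bessel_solution \<alpha> 1 z = 0"
  proof (rule sturm_zero_between[of a b "b + 1"])
    show "solves_on {a<..<b + 1} (\<lambda>x. 1\<^sup>2 + (1/4 - \<alpha>\<^sup>2) / x\<^sup>2) (bessel_solution \<alpha> 1) (bessel_solution' \<alpha> 1)"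
      by (rule solves_on_mono[OF bessel_solution_solves[OF assms]]) (use a in auto)
    show "solves_on {a<..<b + 1} (\<lambda>x. 1/4) (\<lambda>x. sin ((x - p) / 2)) (\<lambda>x. cos ((x - p) / 2) / 2)"
      unfolding solves_on_def by (auto intro!: derivative_eq_intros)
    fix x assume x: "a < x" "x < b + 1"
    have "4 * \<alpha>\<^sup>2 \<le> (2 * (\<bar>\<alpha>\<bar> + 1))\<^sup>2" by (simp add: power2_eq_square algebra_simps)
    moreover have "(2 * (\<bar>\<alpha>\<bar> + 1))\<^sup>2 < x\<^sup>2" using a x by (intro power_strict_mono) auto
    ultimately have "4 * \<alpha>\<^sup>2 < x\<^sup>2" by linarith
    then have "1 / 4 - \<alpha>\<^sup>2 > - (3/4) * x\<^sup>2" using zero_le_power2[of x] by linarith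
    then have "(1 / 4 - \<alpha>\<^sup>2) / x\<^sup>2 > - (3/4)" using a x by (subst pos_less_divide_eq) auto
    then show "1/4 < 1\<^sup>2 + (1/4 - \<alpha>\<^sup>2) / x\<^sup>2"
      unfolding power_one by linarith
  next
    fix x assume "p < x" "x < b"
    then have "0 < (x - p) / 2" "(x - p) / 2 < pi" by (auto simp: b_def)
    then have "sin ((x - p) / 2) > 0" by (rule sin_gt_zero)
    then show "sin ((x - p) / 2) \<noteq> 0" by simp
  next
    show "p < b" by (simp add: b_def)
    then show "a < b" by (simp add: p_def)
  qed (auto simp: p_def b_def)
  then obtain z where "p < z" "bessel_solution \<alpha> 1 z = 0" by auto
  then show ?thesis using a bessel_solution_eq_0_iff[OF assms, of 1 z]
    by (intro exI[of _ z]) (auto simp: p_def)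
qed

text \<open>
  There are infinitely many positive zeros, but only finitely many below any bound.
\<close>

lemma is_kth_least_bessel_zero:
  assumes "\<alpha> > -1" "1 \<le> k"
  shows "is_kth_least {x. 0 < x \<and> bessel_J \<alpha> x = 0} k (bessel_zero \<alpha> k)"
  unfolding bessel_zero_def
proof -
  let ?S = "{x. 0 < x \<and> bessel_J \<alpha> x = 0}"
  have fin: "finite {y \<in> ?S. y \<le> x}" for x
  proof -
    have "(\<lambda>y. y\<^sup>2) ` {y \<in> ?S. y \<le> x} \<subseteq> {y. \<bar>y\<bar> \<le> x\<^sup>2 \<and> bessel_entire \<alpha> y = 0}"
    proof (intro image_subsetI)
      fix y assume y: "y \<in> {y \<in> ?S. y \<le> x}"
      then have "y\<^sup>2 \<le> x\<^sup>2" by (intro power_mono) auto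
      then show "y\<^sup>2 \<in> {y. \<bar>y\<bar> \<le> x\<^sup>2 \<and> bessel_entire \<alpha> y = 0}"
        using y bessel_J_eq_bessel_entire[OF assms(1), of y] by simp
    qed
    then have "finite ((\<lambda>y. y\<^sup>2) ` {y \<in> ?S. y \<le> x})"
      using finite_bessel_entire_zeros[OF assms(1)] by (rule finite_subset)
    then show ?thesis by (rule finite_imageD) (auto simp: inj_on_def power2_eq_iff)
  qed
  have "infinite ?S"
  proof
    assume "finite ?S"
    then obtain B where "\<And>x. x \<in> ?S \<Longrightarrow> x \<le> B" using bdd_above_finite bdd_above.unfold by metis
    then show False using bessel_J_zero_beyond[OF assms(1), of B] by fastforce
  qed
  then obtain T where "finite T" "card T = k" "T \<subseteq> ?S" using infinite_arbitrarily_large by blast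
  then show "is_kth_least ?S k (kth_least ?S k)"
    by (intro is_kth_least_kth_least[OF fin assms(2)]) auto
qed

section \<open>Comparison of the two normal forms\<close>

text \<open>
  The coefficient of the normal form of the Jacobi equation in the variable \<open>\<theta>\<close>.
\<close>

definition jacobi_Q :: "real \<Rightarrow> real \<Rightarrow> nat \<Rightarrow> real \<Rightarrow> real" where
  "jacobi_Q \<alpha> \<beta> n x = (real n + jacobi_rho \<alpha> \<beta>)\<^sup>2 +
     (1/4 - \<alpha>\<^sup>2) / (4 * (sin (x / 2))\<^sup>2) + (1/4 - \<beta>\<^sup>2) / (4 * (cos (x / 2))\<^sup>2)"

text \<open>
  The coefficient of the first derivative in the equation for \<open>P\<^sub>n(cos \<theta>)\<close>, in half-angle form;
  the next definition is the factor that removes this term.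
\<close>

definition jacobi_drift :: "real \<Rightarrow> real \<Rightarrow> real \<Rightarrow> real" where
  "jacobi_drift \<alpha> \<beta> x = (\<alpha> + 1/2) * (cos (x / 2) / sin (x / 2)) - (\<beta> + 1/2) * (sin (x / 2) / cos (x / 2))"

definition jacobi_factor :: "real \<Rightarrow> real \<Rightarrow> real \<Rightarrow> real" where
  "jacobi_factor \<alpha> \<beta> x = sin (x / 2) powr (\<alpha> + 1/2) * cos (x / 2) powr (\<beta> + 1/2)"

definition jacobi_solution :: "real \<Rightarrow> real \<Rightarrow> nat \<Rightarrow> real \<Rightarrow> real" where
  "jacobi_solution \<alpha> \<beta> n x = jacobi_factor \<alpha> \<beta> x * poly (jacobi_series \<alpha> \<beta> n) (cos x)"

definition jacobi_solution' :: "real \<Rightarrow> real \<Rightarrow> nat \<Rightarrow> real \<Rightarrow> real" where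
  "jacobi_solution' \<alpha> \<beta> n x = jacobi_factor \<alpha> \<beta> x *
     (- sin x * poly (pderiv (jacobi_series \<alpha> \<beta> n)) (cos x) +
      jacobi_drift \<alpha> \<beta> x / 2 * poly (jacobi_series \<alpha> \<beta> n) (cos x))"

lemma jacobi_series_ode:
  assumes "\<alpha> > -1"
  shows "(1 - x\<^sup>2) * poly (pderiv (pderiv (jacobi_series \<alpha> \<beta> n))) x =
     - (\<beta> - \<alpha> - (\<alpha> + \<beta> + 2) * x) * poly (pderiv (jacobi_series \<alpha> \<beta> n)) x
     - jacobi_eigenvalue \<alpha> \<beta> n * poly (jacobi_series \<alpha> \<beta> n) x"
  using arg_cong[OF jacobi_op_series[OF assms, of \<beta> n], of "\<lambda>p. poly p x"]
  by (simp add: jacobi_op_def power2_eq_square algebra_simps)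

lemma half_angle_pos:
  fixes x :: real
  assumes "0 < x" "x < pi"
  shows "0 < sin (x / 2)" "0 < cos (x / 2)"
  using assms by (auto intro!: sin_gt_zero cos_gt_zero)

lemma jacobi_factor_deriv:
  assumes "0 < x" "x < pi"
  shows "(jacobi_factor \<alpha> \<beta> has_real_derivative jacobi_factor \<alpha> \<beta> x * (jacobi_drift \<alpha> \<beta> x / 2)) (at x)"
proof -
  note pos = half_angle_pos[OF assms]
  have s: "((\<lambda>x. sin (x / 2)) has_real_derivative cos (x / 2) / 2) (at x)"
    and c: "((\<lambda>x. cos (x / 2)) has_real_derivative - sin (x / 2) / 2) (at x)"
    by (auto intro!: derivative_eq_intros)
  define S C where "S = sin (x / 2)" and "C = cos (x / 2)"
  have pr: "y powr (r + 1/2 - 1) = y powr (r + 1/2) / y" if "y > 0" for y r :: real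
    using that powr_diff[of y "r + 1/2" 1] by simp
  have ds: "((\<lambda>x. sin (x / 2) powr (\<alpha> + 1/2)) has_real_derivative
      (\<alpha> + 1/2) * (S powr (\<alpha> + 1/2) / S) * (C / 2)) (at x)"
    using DERIV_chain2[where f = "\<lambda>y. y powr (\<alpha> + 1/2)" and g = "\<lambda>x. sin (x / 2)",
        OF has_real_derivative_powr[OF pos(1)] s] pr[OF pos(1), of \<alpha>]
    unfolding S_def C_def by simp
  have dc: "((\<lambda>x. cos (x / 2) powr (\<beta> + 1/2)) has_real_derivative
      (\<beta> + 1/2) * (C powr (\<beta> + 1/2) / C) * (- S / 2)) (at x)"
    using DERIV_chain2[where f = "\<lambda>y. y powr (\<beta> + 1/2)" and g = "\<lambda>x. cos (x / 2)",
        OF has_real_derivative_powr[OF pos(2)] c] pr[OF pos(2), of \<beta>]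
    unfolding S_def C_def by simp
  have val: "(\<alpha> + 1/2) * (P / S) * (C / 2) * R + (\<beta> + 1/2) * (R / C) * (- S / 2) * P =
     P * R * (((\<alpha> + 1/2) * (C / S) - (\<beta> + 1/2) * (S / C)) / 2)" for P R
    by (simp add: algebra_simps)
  show ?thesis
    unfolding jacobi_factor_def[abs_def] jacobi_drift_def
    by (rule DERIV_cong[OF DERIV_mult[OF ds dc]]) (simp only: val flip: S_def C_def)
qed

lemma jacobi_drift_deriv:
  assumes "0 < x" "x < pi"
  shows "(jacobi_drift \<alpha> \<beta> has_real_derivative
     - ((\<alpha> + 1/2) / (2 * (sin (x / 2))\<^sup>2)) - (\<beta> + 1/2) / (2 * (cos (x / 2))\<^sup>2)) (at x)"
proof -
  note pos = half_angle_pos[OF assms]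
  define S C where "S = sin (x / 2)" and "C = cos (x / 2)"
  have SC: "S * S + C * C = 1" by (simp add: S_def C_def flip: power2_eq_square)
  have "((\<lambda>x. cos (x / 2) / sin (x / 2)) has_real_derivative
      ((- S / 2) * S - C * (C / 2)) / (S * S)) (at x)"
    unfolding S_def C_def using pos
    by (intro DERIV_divide) (auto intro!: derivative_eq_intros)
  also have "((- S / 2) * S - C * (C / 2)) / (S * S) = - 1 / (2 * S\<^sup>2)"
  proof -
    have "(- S / 2) * S - C * (C / 2) = - (1 / 2)" using SC by (simp add: field_simps)
    then show ?thesis by (simp only:) (simp add: power2_eq_square)
  qed
  finally have d1: "((\<lambda>x. cos (x / 2) / sin (x / 2)) has_real_derivative - 1 / (2 * S\<^sup>2)) (at x)" .
  have "((\<lambda>x. sin (x / 2) / cos (x / 2)) has_real_derivative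
      ((C / 2) * C - S * (- S / 2)) / (C * C)) (at x)"
    unfolding S_def C_def using pos
    by (intro DERIV_divide) (auto intro!: derivative_eq_intros)
  also have "((C / 2) * C - S * (- S / 2)) / (C * C) = 1 / (2 * C\<^sup>2)"
  proof -
    have "(C / 2) * C - S * (- S / 2) = 1 / 2" using SC by (simp add: field_simps)
    then show ?thesis by (simp only:) (simp add: power2_eq_square)
  qed
  finally have d2: "((\<lambda>x. sin (x / 2) / cos (x / 2)) has_real_derivative 1 / (2 * C\<^sup>2)) (at x)" .
  show ?thesis
    unfolding jacobi_drift_def[abs_def]
    by (rule DERIV_cong[OF DERIV_diff[OF DERIV_cmult[OF d1] DERIV_cmult[OF d2]]])
       (simp add: S_def C_def)
qed

lemma jacobi_solution_solves:
  assumes "\<alpha> > -1"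
  shows "solves_on {0<..<pi} (jacobi_Q \<alpha> \<beta> n) (jacobi_solution \<alpha> \<beta> n) (jacobi_solution' \<alpha> \<beta> n)"
proof -
  let ?P = "jacobi_series \<alpha> \<beta> n" and ?l = "jacobi_eigenvalue \<alpha> \<beta> n"
  let ?r = "jacobi_drift \<alpha> \<beta>"
  let ?r' = "\<lambda>x. - ((\<alpha> + 1/2) / (2 * (sin (x / 2))\<^sup>2)) - (\<beta> + 1/2) / (2 * (cos (x / 2))\<^sup>2)"
  have "solves_on {0<..<pi} (\<lambda>x. ?l - (?r x)\<^sup>2 / 4 - ?r' x / 2)
     (\<lambda>x. jacobi_factor \<alpha> \<beta> x * poly ?P (cos x))
     (\<lambda>x. jacobi_factor \<alpha> \<beta> x * (- sin x * poly (pderiv ?P) (cos x) + ?r x / 2 * poly ?P (cos x)))"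
  proof (rule liouville_normal_form)
    fix x :: real assume "x \<in> {0<..<pi}"
    then have x: "0 < x" "x < pi" by auto
    note pos = half_angle_pos[OF x]
    show "(jacobi_factor \<alpha> \<beta> has_real_derivative jacobi_factor \<alpha> \<beta> x * (?r x / 2)) (at x)"
      by (rule jacobi_factor_deriv[OF x])
    show "(?r has_real_derivative ?r' x) (at x)"
      by (rule jacobi_drift_deriv[OF x])
    have dp: "((\<lambda>x. poly p (cos x)) has_real_derivative - sin x * poly (pderiv p) (cos x)) (at x)" for p
      by (rule DERIV_cong[OF DERIV_chain2[where f = "poly p", OF poly_DERIV DERIV_cos]]) simp
    show "((\<lambda>x. poly ?P (cos x)) has_real_derivative - sin x * poly (pderiv ?P) (cos x)) (at x)"
      by (rule dp)
    define S C where "S = sin (x / 2)" and "C = cos (x / 2)"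
    have SC: "C * C = 1 - S * S" by (simp add: S_def C_def flip: power2_eq_square add: cos_squared_eq)
    have trig: "sin x = 2 * S * C" "cos x = 1 - 2 * (S * S)"
      using sin_double[of "x / 2"] cos_double_sin[of "x / 2"]
      by (simp_all add: S_def C_def power2_eq_square)
    have "?r x * sin x = (2 * \<alpha> + 1) * (C * C) - (2 * \<beta> + 1) * (S * S)"
      unfolding jacobi_drift_def S_def[symmetric] C_def[symmetric] trig(1)
      using pos by (simp add: S_def C_def field_simps)
    also have "\<dots> = \<alpha> - \<beta> + (\<alpha> + \<beta> + 1) * cos x"
      unfolding trig SC by (simp add: algebra_simps)
    finally have rsin: "?r x * sin x = \<alpha> - \<beta> + (\<alpha> + \<beta> + 1) * cos x" .
    have sin2: "sin x * sin x = 1 - (cos x)\<^sup>2"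
      by (simp add: sin_squared_eq flip: power2_eq_square)
    have "((\<lambda>x. - sin x * poly (pderiv ?P) (cos x)) has_real_derivative
        (sin x * sin x) * poly (pderiv (pderiv ?P)) (cos x) - cos x * poly (pderiv ?P) (cos x)) (at x)"
      by (rule DERIV_cong[OF DERIV_mult[OF DERIV_minus[OF DERIV_sin] dp]]) (simp add: algebra_simps)
    also have "(sin x * sin x) * poly (pderiv (pderiv ?P)) (cos x) - cos x * poly (pderiv ?P) (cos x) =
        - (?r x * (- sin x * poly (pderiv ?P) (cos x)) + ?l * poly ?P (cos x))"
    proof -
      have "?r x * (- sin x * poly (pderiv ?P) (cos x)) = - (?r x * sin x) * poly (pderiv ?P) (cos x)"
        by simp
      then show ?thesis
        unfolding sin2 jacobi_series_ode[OF assms] rsin by (simp add: algebra_simps)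
    qed
    finally show "((\<lambda>x. - sin x * poly (pderiv ?P) (cos x)) has_real_derivative
        - (?r x * (- sin x * poly (pderiv ?P) (cos x)) + ?l * poly ?P (cos x))) (at x)" .
  qed
  then have "solves_on {0<..<pi} (\<lambda>x. ?l - (?r x)\<^sup>2 / 4 - ?r' x / 2) (jacobi_solution \<alpha> \<beta> n) (jacobi_solution' \<alpha> \<beta> n)"
    unfolding jacobi_solution_def[abs_def] jacobi_solution'_def[abs_def] .
  then show ?thesis
  proof (rule solves_on_cong)
    fix x :: real assume "x \<in> {0<..<pi}"
    then have x: "0 < x" "x < pi" by auto
    note pos = half_angle_pos[OF x]
    define S C where "S = (sin (x / 2))\<^sup>2" and "C = (cos (x / 2))\<^sup>2"
    have SC: "S > 0" "C > 0" using pos by (auto simp: S_def C_def)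
    have SC1: "C = 1 - S" by (simp add: S_def C_def cos_squared_eq)
    have CS: "(cos (x / 2) / sin (x / 2))\<^sup>2 = 1 / S - 1" "(sin (x / 2) / cos (x / 2))\<^sup>2 = 1 / C - 1"
      unfolding power_divide S_def[symmetric] C_def[symmetric] using SC SC1 by (auto simp: field_simps)
    have "(cos (x / 2) / sin (x / 2)) * (sin (x / 2) / cos (x / 2)) = 1" using pos by simp
    moreover have "(a * p - b * q)\<^sup>2 = a\<^sup>2 * p\<^sup>2 - 2 * a * b * (p * q) + b\<^sup>2 * q\<^sup>2" for a b p q :: real
      by (simp add: power2_eq_square algebra_simps)
    ultimately have "(?r x)\<^sup>2 = (\<alpha> + 1/2)\<^sup>2 * (1 / S - 1) - 2 * (\<alpha> + 1/2) * (\<beta> + 1/2) + (\<beta> + 1/2)\<^sup>2 * (1 / C - 1)"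
      unfolding CS[symmetric] jacobi_drift_def by (simp only: mult_1_right)
    then show "?l - (?r x)\<^sup>2 / 4 - ?r' x / 2 = jacobi_Q \<alpha> \<beta> n x"
      unfolding jacobi_Q_def jacobi_rho_def jacobi_eigenvalue_def S_def[symmetric] C_def[symmetric]
      by (simp add: power2_eq_square algebra_simps add_divide_distrib diff_divide_distrib)
  qed
qed

lemma jacobi_solution_eq_0_iff:
  assumes "0 < x" "x < pi"
  shows "jacobi_solution \<alpha> \<beta> n x = 0 \<longleftrightarrow> poly (jacobi_series \<alpha> \<beta> n) (cos x) = 0"
  using half_angle_pos[OF assms] by (simp add: jacobi_solution_def jacobi_factor_def)

text \<open>
  Both solutions are a factor of size \<open>x\<close> to the power \<open>\<alpha> + 1/2\<close> times a function that is even and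
  smooth at 0. In the Wronskian this leaves a factor of size \<open>x\<close> to the power \<open>2 \<alpha> + 1\<close>, times a
  combination of the derivatives of the smooth parts and the difference of the two first-order
  coefficients, which is of order \<open>x\<close>. The total exponent \<open>2 \<alpha> + 2\<close> is positive.
\<close>

lemma wronskian_jacobi_bessel:
  assumes "\<alpha> > -1"
  shows "((\<lambda>x. jacobi_solution \<alpha> \<beta> n x * bessel_solution' \<alpha> c x -
                jacobi_solution' \<alpha> \<beta> n x * bessel_solution \<alpha> c x) \<longlongrightarrow> 0) (at_right 0)"
proof -
  let ?P = "jacobi_series \<alpha> \<beta> n"
  let ?U = "\<lambda>x. poly ?P (cos x)" and ?V = "\<lambda>x. bessel_entire \<alpha> (c\<^sup>2 * x\<^sup>2)"
  let ?V1 = "\<lambda>x. bessel_entire' \<alpha> (c\<^sup>2 * x\<^sup>2)" and ?U1 = "\<lambda>x. poly (pderiv ?P) (cos x)"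
  \<comment> \<open>the Wronskian, rearranged into factors that have a limit at 0\<close>
  define W where "W x = ((sin (x / 2) / x) powr (\<alpha> + 1/2) * cos (x / 2) powr (\<beta> + 1/2) * x powr (2 * \<alpha> + 2)) *
     (2 * c\<^sup>2 * ?U x * ?V1 x + sin x / x * ?U1 x * ?V x +
      ((2 * \<alpha> + 1) * ((1 / x - cos (x / 2) / sin (x / 2) / 2) / x) +
       (\<beta> + 1/2) * (sin (x / 2) / cos (x / 2) / x)) / 2 * (?U x * ?V x))" for x
  have contP: "((\<lambda>x. poly p (cos x)) \<longlongrightarrow> poly p 1) (at_right 0)" for p :: "real poly"
    using tendsto_poly[OF tendsto_cos[OF tendsto_ident_at], of p 0 "{0<..}"] by simp
  have sq: "((\<lambda>x. c\<^sup>2 * x\<^sup>2) \<longlongrightarrow> 0) (at_right 0)" by real_asymp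
  have contV: "(?V \<longlongrightarrow> bessel_entire \<alpha> 0) (at_right 0)" "(?V1 \<longlongrightarrow> bessel_entire' \<alpha> 0) (at_right 0)"
    by (rule isCont_tendsto_compose[OF DERIV_isCont[OF bessel_entire_deriv(1)[OF assms]] sq]
        isCont_tendsto_compose[OF DERIV_isCont[OF bessel_entire_deriv(2)[OF assms]] sq])+
  have e: "((\<lambda>x::real. sin (x / 2) / x) \<longlongrightarrow> 1 / 2) (at_right 0)"
          "((\<lambda>x::real. cos (x / 2)) \<longlongrightarrow> 1) (at_right 0)"
          "((\<lambda>x::real. sin x / x) \<longlongrightarrow> 1) (at_right 0)"
          "((\<lambda>x::real. (1 / x - cos (x / 2) / sin (x / 2) / 2) / x) \<longlongrightarrow> 1 / 12) (at_right 0)"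
          "((\<lambda>x::real. sin (x / 2) / cos (x / 2) / x) \<longlongrightarrow> 1 / 2) (at_right 0)"
    by real_asymp+
  have "2 * \<alpha> + 2 > 0" using assms by simp
  then have pw: "((\<lambda>x::real. x powr (2 * \<alpha> + 2)) \<longlongrightarrow> 0) (at_right 0)" by real_asymp
  have "(W \<longlongrightarrow> ((1/2) powr (\<alpha> + 1/2) * 1 powr (\<beta> + 1/2) * 0) *
     (2 * c\<^sup>2 * poly ?P 1 * bessel_entire' \<alpha> 0 + 1 * poly (pderiv ?P) 1 * bessel_entire \<alpha> 0 +
      ((2 * \<alpha> + 1) * (1 / 12) + (\<beta> + 1/2) * (1 / 2)) / 2 * (poly ?P 1 * bessel_entire \<alpha> 0))) (at_right 0)"
    unfolding W_def[abs_def] 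
    by (rule tendsto_const e pw contP contV tendsto_mult tendsto_add tendsto_divide tendsto_powr | simp)+
  then have "(W \<longlongrightarrow> 0) (at_right 0)" by simp
  moreover have "\<forall>\<^sub>F x in at_right 0. x \<in> {0<..<pi}" by (rule eventually_at_right_real) simp
  then have "\<forall>\<^sub>F x in at_right 0. W x = jacobi_solution \<alpha> \<beta> n x * bessel_solution' \<alpha> c x -
                jacobi_solution' \<alpha> \<beta> n x * bessel_solution \<alpha> c x"
  proof eventually_elim
    case (elim x)
    then have x: "0 < x" "x < pi" by auto
    define A where "A = sin (x / 2) powr (\<alpha> + 1/2)"
    define B where "B = cos (x / 2) powr (\<beta> + 1/2)"
    define D where "D = x powr (\<alpha> + 1/2)"
    have "x powr (2 * \<alpha> + 2) = x powr (\<alpha> + 1/2 + (\<alpha> + 1/2) + 1)" by (simp add: algebra_simps)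
    also have "\<dots> = D * D * x" using x unfolding powr_add D_def by simp
    finally have D2: "x powr (2 * \<alpha> + 2) = D * D * x" .
    have "(sin (x / 2) / x) powr (\<alpha> + 1/2) = A / D"
      unfolding A_def D_def by (rule powr_divide)
    moreover have "D \<noteq> 0" using x by (simp add: D_def)
    ultimately have AB: "(sin (x / 2) / x) powr (\<alpha> + 1/2) * cos (x / 2) powr (\<beta> + 1/2) * x powr (2 * \<alpha> + 2)
        = A * B * D * x"
      unfolding D2 B_def[symmetric] by simp
    have id: "A * B * D * x * (2 * c2 * U * V1 + s / x * U1 * V +
        ((2 * \<alpha> + 1) * ((1 / x - p / 2) / x) + (\<beta> + 1/2) * (q / x)) / 2 * (U * V)) =
      A * B * U * (D * (2 * c2 * x * V1 + (2 * \<alpha> + 1) / x / 2 * V)) -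
      A * B * (- s * U1 + ((\<alpha> + 1/2) * p - (\<beta> + 1/2) * q) / 2 * U) * (D * V)"
      for c2 U V U1 V1 s p q
      using x(1) by (simp add: field_simps)
    show ?case
      unfolding W_def AB unfolding jacobi_solution_def jacobi_solution'_def bessel_solution_def
        bessel_solution'_def jacobi_factor_def jacobi_drift_def
        A_def[symmetric] B_def[symmetric] D_def[symmetric]
      by (rule id)
  qed
  ultimately show ?thesis by (rule Lim_transform_eventually)
qed

lemma bessel_zero_scaled:
  assumes "\<alpha> > -1" "1 \<le> k" "c > 0"
  shows "is_kth_least {x. 0 < x \<and> bessel_solution \<alpha> c x = 0} k (bessel_zero \<alpha> k / c)"
proof -
  have "{x. 0 < x \<and> bessel_solution \<alpha> c x = 0} = {t. c * t \<in> {x. 0 < x \<and> bessel_J \<alpha> x = 0}}"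
    using assms bessel_solution_eq_0_iff[OF assms(1,3)] by (auto simp: zero_less_mult_iff)
  then show ?thesis
    using is_kth_least_divide[OF is_kth_least_bessel_zero[OF assms(1,2)] assms(3)] by simp
qed

lemma jacobi_theta_solution:
  assumes "\<alpha> > -1" "\<beta> > -1" "n \<ge> 1" "1 \<le> k" "k \<le> n"
  shows "is_kth_least {x. 0 < x \<and> x < pi \<and> jacobi_solution \<alpha> \<beta> n x = 0} k (jacobi_theta \<alpha> \<beta> n k)"
proof -
  have "{x. 0 < x \<and> x < pi \<and> jacobi_solution \<alpha> \<beta> n x = 0} =
     {\<theta>. 0 < \<theta> \<and> \<theta> < pi \<and> poly (jacobi_series \<alpha> \<beta> n) (cos \<theta>) = 0}"
    using jacobi_solution_eq_0_iff[of _ \<alpha> \<beta> n] by blast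
  then show ?thesis using is_kth_least_jacobi_theta[OF assms] by simp
qed

text \<open>
  If the Bessel zero is not below \<open>\<pi>\<close>, there is nothing to compare, since all \<open>\<theta>\<^sub>n\<^sub>,\<^sub>k\<close> are.
\<close>

lemma jacobi_theta_less_bessel_zero:
  assumes "\<alpha> > -1" "\<beta> > -1" "n \<ge> 1" "1 \<le> k" "k \<le> n" "c > 0"
    and less: "\<And>x. 0 < x \<Longrightarrow> x < pi \<Longrightarrow> c\<^sup>2 + (1/4 - \<alpha>\<^sup>2) / x\<^sup>2 < jacobi_Q \<alpha> \<beta> n x"
  shows "jacobi_theta \<alpha> \<beta> n k < bessel_zero \<alpha> k / c"
proof (cases "bessel_zero \<alpha> k / c < pi")
  case True
  have v: "solves_on {0<..<pi} (\<lambda>x. c\<^sup>2 + (1/4 - \<alpha>\<^sup>2) / x\<^sup>2) (bessel_solution \<alpha> c) (bessel_solution' \<alpha> c)"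
    by (rule solves_on_mono[OF bessel_solution_solves[OF assms(1)]]) auto
  show ?thesis
  proof (rule sturm_kth_zero_less[OF pi_gt_zero jacobi_solution_solves[OF assms(1), of \<beta> n] v])
    show "is_kth_least {x. 0 < x \<and> bessel_solution \<alpha> c x = 0} k (bessel_zero \<alpha> k / c)"
      by (rule bessel_zero_scaled[OF assms(1,4,6)])
    show "is_kth_least {x. 0 < x \<and> x < pi \<and> jacobi_solution \<alpha> \<beta> n x = 0} k (jacobi_theta \<alpha> \<beta> n k)"
      by (rule jacobi_theta_solution[OF assms(1-5)])
  qed (simp_all add: less True wronskian_jacobi_bessel[OF assms(1)])
next
  case False
  moreover have "jacobi_theta \<alpha> \<beta> n k < pi"
    using jacobi_theta_solution[OF assms(1-5)] by (simp add: is_kth_least_def)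
  ultimately show ?thesis by simp
qed

lemma bessel_zero_less_jacobi_theta:
  assumes "\<alpha> > -1" "\<beta> > -1" "n \<ge> 1" "1 \<le> k" "k \<le> n" "c > 0"
    and less: "\<And>x. 0 < x \<Longrightarrow> x < pi \<Longrightarrow> jacobi_Q \<alpha> \<beta> n x < c\<^sup>2 + (1/4 - \<alpha>\<^sup>2) / x\<^sup>2"
  shows "bessel_zero \<alpha> k / c < jacobi_theta \<alpha> \<beta> n k"
proof -
  have W: "((\<lambda>x. bessel_solution \<alpha> c x * jacobi_solution' \<alpha> \<beta> n x -
                bessel_solution' \<alpha> c x * jacobi_solution \<alpha> \<beta> n x) \<longlongrightarrow> 0) (at_right 0)"
    using tendsto_minus[OF wronskian_jacobi_bessel[OF assms(1), of \<beta> n c]] by (simp add: mult.commute)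
  note theta = jacobi_theta_solution[OF assms(1-5)]
  have u: "solves_on {0<..<pi} (\<lambda>x. c\<^sup>2 + (1/4 - \<alpha>\<^sup>2) / x\<^sup>2) (bessel_solution \<alpha> c) (bessel_solution' \<alpha> c)"
    by (rule solves_on_mono[OF bessel_solution_solves[OF assms(1)]]) auto
  show ?thesis
  proof (rule sturm_kth_zero_less[OF pi_gt_zero u jacobi_solution_solves[OF assms(1), of \<beta> n] less W])
    show "is_kth_least {x. 0 < x \<and> bessel_solution \<alpha> c x = 0} k (bessel_zero \<alpha> k / c)"
      by (rule bessel_zero_scaled[OF assms(1,4,6)])
    show "is_kth_least {x. 0 < x \<and> x < pi \<and> jacobi_solution \<alpha> \<beta> n x = 0} k (jacobi_theta \<alpha> \<beta> n k)"
      by (rule theta)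
  qed (use theta in \<open>simp_all add: is_kth_least_def\<close>)
qed

section \<open>Bounds for the potential from bounds for \<open>\<Phi>\<close>\<close>

lemma cos_ge_one_minus: "1 - x\<^sup>2 / 2 \<le> cos (x::real)"
proof -
  have "\<bar>sin (x / 2)\<bar> \<le> \<bar>x / 2\<bar>" by (rule abs_sin_x_le_abs_x)
  then have "(sin (x / 2))\<^sup>2 \<le> (x / 2)\<^sup>2" by (rule abs_le_square_iff[THEN iffD1])
  moreover have "cos x = 1 - 2 * (sin (x / 2))\<^sup>2" using cos_double_sin[of "x / 2"] by simp
  ultimately show ?thesis by (simp add: power_divide)
qed

lemma sin_ge_cubic:
  assumes "0 \<le> (x::real)"
  shows "x - x ^ 3 / 6 \<le> sin x"
proof -
  have "(\<lambda>t. sin t - (t - t ^ 3 / 6)) 0 \<le> (\<lambda>t. sin t - (t - t ^ 3 / 6)) x"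
  proof (rule DERIV_nonneg_imp_nondecreasing[OF assms])
    fix t :: real
    have "((\<lambda>t. sin t - (t - t ^ 3 / 6)) has_real_derivative cos t - (1 - t\<^sup>2 / 2)) (at t)"
      by (auto intro!: derivative_eq_intros)
    moreover have "0 \<le> cos t - (1 - t\<^sup>2 / 2)" using cos_ge_one_minus[of t] by simp
    ultimately show "\<exists>y. ((\<lambda>t. sin t - (t - t ^ 3 / 6)) has_real_derivative y) (at t) \<and> 0 \<le> y" by blast
  qed
  then show ?thesis by simp
qed

lemma x_cos_le_sin:
  assumes "0 \<le> (x::real)" "x \<le> pi"
  shows "x * cos x \<le> sin x"
proof -
  have "(\<lambda>t. sin t - t * cos t) 0 \<le> (\<lambda>t. sin t - t * cos t) x"
  proof (rule DERIV_nonneg_imp_nondecreasing[OF assms(1)])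
    fix t :: real assume t: "0 \<le> t" "t \<le> x"
    have "((\<lambda>t. sin t - t * cos t) has_real_derivative t * sin t) (at t)"
      by (auto intro!: derivative_eq_intros)
    moreover have "0 \<le> t * sin t" using t assms by (intro mult_nonneg_nonneg sin_ge_zero) auto
    ultimately show "\<exists>y. ((\<lambda>t. sin t - t * cos t) has_real_derivative y) (at t) \<and> 0 \<le> y" by blast
  qed
  then show ?thesis by simp
qed

lemma first_quadrant:
  fixes x :: real
  assumes "0 < x" "x < pi / 2"
  shows "0 < sin x" "0 < cos x" "x\<^sup>2 < 4"
proof -
  show "0 < sin x" "0 < cos x" using assms by (auto intro!: sin_gt_zero cos_gt_zero)
  have "x < 2" using assms pi_half_less_two by simp
  then show "x\<^sup>2 < 4" using assms power_strict_mono[of x 2 2] by simp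
qed

text \<open>
  From \<open>sin x \<ge> x - x\<^sup>3/6\<close> one gets \<open>x\<^sup>2 - sin\<^sup>2 x < x\<^sup>4/3\<close>, and \<open>x cos x \<le> sin x\<close> does the rest. The
  constant 3 is optimal, because both sides tend to \<open>1/3\<close> at 0. It therefore fits the necessary condition
  \<open>a/3 + b \<ge> 0\<close> that arises in \<open>trig_potential_gt\<close>.
\<close>

lemma csc_square_minus_less:
  fixes x :: real
  assumes "0 < x" "x < pi / 2"
  shows "1 / (sin x)\<^sup>2 - 1 / x\<^sup>2 < 1 / (3 * (cos x)\<^sup>2)"
proof -
  note q = first_quadrant[OF assms]
  define S C where "S = (sin x)\<^sup>2" and "C = (cos x)\<^sup>2"
  have pos: "S > 0" "C > 0" "x\<^sup>2 > 0" using q assms by (auto simp: S_def C_def)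
  have "0 \<le> x * (1 - x\<^sup>2 / 6)" using assms q by simp
  moreover have "x * (1 - x\<^sup>2 / 6) \<le> sin x"
    using sin_ge_cubic[of x] assms by (simp add: algebra_simps power2_eq_square power3_eq_cube)
  ultimately have "(x * (1 - x\<^sup>2 / 6))\<^sup>2 \<le> S" unfolding S_def by (intro power_mono)
  moreover have "(x * (1 - x\<^sup>2 / 6))\<^sup>2 = x\<^sup>2 - x\<^sup>2 * x\<^sup>2 / 3 + x\<^sup>2 * x\<^sup>2 * x\<^sup>2 / 36"
    by (simp add: power2_eq_square field_simps)
  moreover have "x\<^sup>2 * x\<^sup>2 * x\<^sup>2 > 0" using pos by simp
  ultimately have "3 * (x\<^sup>2 - S) < x\<^sup>2 * x\<^sup>2" by argo
  then have "C * (3 * (x\<^sup>2 - S)) < C * (x\<^sup>2 * x\<^sup>2)" using pos by (simp only: mult_less_cancel_left_pos)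
  also have "(x * cos x)\<^sup>2 \<le> S" unfolding S_def
    using x_cos_le_sin[of x] assms q by (intro power_mono) auto
  then have "C * (x\<^sup>2 * x\<^sup>2) \<le> S * x\<^sup>2"
    using mult_right_mono[of "C * x\<^sup>2" S "x\<^sup>2"] by (simp add: C_def power_mult_distrib mult_ac)
  finally have *: "3 * C * (x\<^sup>2 - S) < S * x\<^sup>2" by (simp add: mult_ac)
  have "1 / S - 1 / x\<^sup>2 = (3 * C * (x\<^sup>2 - S)) / (3 * C * (S * x\<^sup>2))" using pos by (simp add: field_simps)
  also have "\<dots> < (S * x\<^sup>2) / (3 * C * (S * x\<^sup>2))" using * pos by (intro divide_strict_right_mono) auto
  also have "\<dots> = 1 / (3 * C)" using pos by (simp add: field_simps)
  finally show ?thesis by (simp add: S_def C_def)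
qed

text \<open>
  The singular terms of the Jacobi coefficient, and \<open>\<Phi>\<close>, with arbitrary weights \<open>a\<close> and \<open>b\<close>. Both are
  linear in the weights, so a statement about an upper bound is one about a lower bound for \<open>- a\<close>
  and \<open>- b\<close>.
\<close>

definition trig_potential :: "real \<Rightarrow> real \<Rightarrow> real \<Rightarrow> real" where
  "trig_potential a b x = a / (sin x)\<^sup>2 + b / (cos x)\<^sup>2"

definition trig_Phi :: "real \<Rightarrow> real \<Rightarrow> real \<Rightarrow> real" where
  "trig_Phi a b x = a * ((1 - x * cot x) / (sin x)\<^sup>2) + b * ((1 + x * tan x) / (cos x)\<^sup>2)"

lemma trig_Phi_uminus: "trig_Phi (- a) (- b) x = - trig_Phi a b x"
  by (simp add: trig_Phi_def)

lemma trig_potential_uminus: "trig_potential (- a) (- b) x = - trig_potential a b x"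
  by (simp add: trig_potential_def)

lemma jacobi_Phi_eq: "jacobi_Phi \<alpha> \<beta> = trig_Phi ((1 - 4 * \<alpha>\<^sup>2) / 16) ((1 - 4 * \<beta>\<^sup>2) / 16)"
  by (simp add: fun_eq_iff jacobi_Phi_def trig_Phi_def)

lemma square_trig_potential_deriv:
  assumes "0 < x" "x < pi / 2"
  shows "((\<lambda>x. x\<^sup>2 * trig_potential a b x) has_real_derivative 2 * x * trig_Phi a b x) (at x)"
proof -
  note q = first_quadrant[OF assms]
  define S C where "S = sin x" and "C = cos x"
  have "((\<lambda>x. x\<^sup>2 / (sin x)\<^sup>2) has_real_derivative 2 * x * ((1 - x * cot x) / (sin x)\<^sup>2)) (at x)"
  proof (rule DERIV_cong)
    show "((\<lambda>x. x\<^sup>2 / (sin x)\<^sup>2) has_real_derivative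
        (2 * x * S\<^sup>2 - x\<^sup>2 * (2 * S * C)) / (S\<^sup>2 * S\<^sup>2)) (at x)"
      unfolding S_def C_def using q by (intro DERIV_divide) (auto intro!: derivative_eq_intros)
    show "(2 * x * S\<^sup>2 - x\<^sup>2 * (2 * S * C)) / (S\<^sup>2 * S\<^sup>2) = 2 * x * ((1 - x * cot x) / (sin x)\<^sup>2)"
      using q by (simp add: cot_def S_def[symmetric] C_def[symmetric] field_simps power2_eq_square)
  qed
  moreover have "((\<lambda>x. x\<^sup>2 / (cos x)\<^sup>2) has_real_derivative 2 * x * ((1 + x * tan x) / (cos x)\<^sup>2)) (at x)"
  proof (rule DERIV_cong)
    show "((\<lambda>x. x\<^sup>2 / (cos x)\<^sup>2) has_real_derivative
        (2 * x * C\<^sup>2 - x\<^sup>2 * (- (2 * S * C))) / (C\<^sup>2 * C\<^sup>2)) (at x)"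
      unfolding S_def C_def using q by (intro DERIV_divide) (auto intro!: derivative_eq_intros)
    show "(2 * x * C\<^sup>2 - x\<^sup>2 * (- (2 * S * C))) / (C\<^sup>2 * C\<^sup>2) = 2 * x * ((1 + x * tan x) / (cos x)\<^sup>2)"
      using q by (simp add: tan_def S_def[symmetric] C_def[symmetric] field_simps power2_eq_square)
  qed
  ultimately have "((\<lambda>x. a * (x\<^sup>2 / (sin x)\<^sup>2) + b * (x\<^sup>2 / (cos x)\<^sup>2)) has_real_derivative
      a * (2 * x * ((1 - x * cot x) / (sin x)\<^sup>2)) + b * (2 * x * ((1 + x * tan x) / (cos x)\<^sup>2))) (at x)"
    by (intro DERIV_add DERIV_cmult)
  then show ?thesis
    by (simp add: trig_potential_def[abs_def] trig_Phi_def distrib_left mult_ac)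
qed

text \<open>
  The function \<open>x\<^sup>2 p(x) - m x\<^sup>2\<close> has the derivative \<open>2 x (\<Phi>(x) - m) \<ge> 0\<close> and the limit \<open>a\<close> at 0.
\<close>

lemma trig_potential_ge:
  assumes "\<And>x. 0 < x \<Longrightarrow> x < pi / 2 \<Longrightarrow> m \<le> trig_Phi a b x" and x: "0 < x" "x < pi / 2"
  shows "a / x\<^sup>2 + m \<le> trig_potential a b x"
proof -
  define G where "G x = x\<^sup>2 * trig_potential a b x - m * x\<^sup>2" for x
  have "((\<lambda>x::real. x\<^sup>2 / (sin x)\<^sup>2) \<longlongrightarrow> 1) (at_right 0)" "((\<lambda>x::real. x\<^sup>2 / (cos x)\<^sup>2) \<longlongrightarrow> 0) (at_right 0)"
       "((\<lambda>x::real. x\<^sup>2) \<longlongrightarrow> 0) (at_right 0)" by real_asymp+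
  then have "((\<lambda>x. a * (x\<^sup>2 / (sin x)\<^sup>2) + b * (x\<^sup>2 / (cos x)\<^sup>2) - m * x\<^sup>2) \<longlongrightarrow> a * 1 + b * 0 - m * 0) (at_right 0)"
    by (intro tendsto_diff tendsto_add tendsto_mult_left)
  moreover have "(\<lambda>x. a * (x\<^sup>2 / (sin x)\<^sup>2) + b * (x\<^sup>2 / (cos x)\<^sup>2) - m * x\<^sup>2) = G"
    by (simp add: G_def fun_eq_iff trig_potential_def algebra_simps)
  ultimately have lim: "(G \<longlongrightarrow> a) (at_right 0)" by simp
  have "a \<le> G x"
  proof (rule tendsto_upperbound[OF lim])
    show "\<forall>\<^sub>F y in at_right 0. G y \<le> G x"
      using eventually_at_right_real[OF x(1)]
    proof eventually_elim
      case (elim y)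
      show "G y \<le> G x"
      proof (rule DERIV_nonneg_imp_nondecreasing[of y x G])
        fix t assume t: "y \<le> t" "t \<le> x"
        then have t': "0 < t" "t < pi / 2" using elim x by auto
        have "(G has_real_derivative 2 * t * trig_Phi a b t - m * (2 * t)) (at t)"
          unfolding G_def[abs_def]
          by (intro DERIV_diff square_trig_potential_deriv t' DERIV_cmult) (auto intro!: derivative_eq_intros)
        moreover have "0 \<le> 2 * t * trig_Phi a b t - m * (2 * t)"
          using mult_right_mono[OF assms(1)[OF t'], of "2 * t"] t' by (simp add: mult_ac)
        ultimately show "\<exists>d. (G has_real_derivative d) (at t) \<and> 0 \<le> d" by blast
      qed (use elim in auto)
    qed
  qed auto
  then have "a / x\<^sup>2 \<le> G x / x\<^sup>2" by (intro divide_right_mono) auto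
  also have "\<dots> = trig_potential a b x - m" using x by (simp add: G_def diff_divide_distrib)
  finally show ?thesis by simp
qed

text \<open>
  For \<open>a \<ge> 0\<close> the reason is \<open>sin x < x\<close>. For \<open>a < 0\<close>, the limit of \<open>\<Phi>\<close> at 0 gives \<open>b \<ge> - a/3\<close>, which is
  just enough for \<open>csc_square_minus_less\<close> to apply.
\<close>

lemma trig_potential_gt:
  assumes nn: "\<And>x. 0 < x \<Longrightarrow> x < pi / 2 \<Longrightarrow> 0 \<le> trig_Phi a b x" and x: "0 < x" "x < pi / 2"
    and b: "0 \<le> b" and ab: "a \<noteq> 0 \<or> b \<noteq> 0"
  shows "a / x\<^sup>2 < trig_potential a b x"
proof -
  note q = first_quadrant[OF x]
  show ?thesis
  proof (cases "0 \<le> a")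
    case True
    have "cos (x / 2) < cos 0" using x by (intro cos_monotone_0_pi) auto
    moreover have "sin (x / 2) > 0" using x by (intro sin_gt_zero) auto
    ultimately have "sin x < 2 * sin (x / 2)" using sin_double[of "x / 2"] by simp
    also have "\<dots> \<le> x" using sin_x_le_x[of "x / 2"] x by simp
    finally have "(sin x)\<^sup>2 < x\<^sup>2" using q by (intro power_strict_mono) auto
    then have l: "1 / x\<^sup>2 < 1 / (sin x)\<^sup>2" using q x by (intro divide_strict_left_mono) auto
    have "b / (cos x)\<^sup>2 \<ge> 0" "b > 0 \<Longrightarrow> b / (cos x)\<^sup>2 > 0" using b q by auto
    moreover have "a / x\<^sup>2 \<le> a / (sin x)\<^sup>2" "a > 0 \<Longrightarrow> a / x\<^sup>2 < a / (sin x)\<^sup>2"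
      using True mult_left_mono[OF less_imp_le[OF l], of a] mult_strict_left_mono[OF l, of a] by auto
    ultimately show ?thesis using True b ab unfolding trig_potential_def by argo
  next
    case False
    have "(trig_Phi a b \<longlongrightarrow> a * (1 / 3) + b * 1) (at_right 0)"
    proof -
      have "((\<lambda>x::real. (1 - x * cot x) / (sin x)\<^sup>2) \<longlongrightarrow> 1 / 3) (at_right 0)"
        unfolding cot_def by real_asymp
      moreover have "((\<lambda>x::real. (1 + x * tan x) / (cos x)\<^sup>2) \<longlongrightarrow> 1) (at_right 0)"
        unfolding tan_def by real_asymp
      ultimately show ?thesis
        unfolding trig_Phi_def[abs_def] by (intro tendsto_add tendsto_mult_left)
    qed
    moreover have "\<forall>\<^sub>F x in at_right 0. 0 \<le> trig_Phi a b x"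
      using eventually_at_right_real[of 0 "pi / 2"] by (auto elim!: eventually_mono intro: nn)
    ultimately have "0 \<le> a * (1 / 3) + b * 1" by (intro tendsto_lowerbound) auto
    then have "- a \<le> 3 * b" by simp
    then have "- a * (1 / (3 * (cos x)\<^sup>2)) \<le> 3 * b * (1 / (3 * (cos x)\<^sup>2))" by (rule mult_right_mono) simp
    moreover have "- a * (1 / (sin x)\<^sup>2 - 1 / x\<^sup>2) < - a * (1 / (3 * (cos x)\<^sup>2))"
      using csc_square_minus_less[OF x] False by (intro mult_strict_left_mono) auto
    ultimately show ?thesis by (simp add: trig_potential_def right_diff_distrib)
  qed
qed

text \<open>
  For \<open>m < 0\<close> put \<open>d = - m / r\<close>. Then \<open>(N - d)\<^sup>2 < N (N - d) = N\<^sup>2 - d N \<le> N\<^sup>2 + m\<close>, as \<open>d > 0\<close> and \<open>N \<ge> r\<close>. In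
  the application \<open>N = n + \<rho>\<close> and \<open>r = 1 + \<rho>\<close>, which is the smallest value of \<open>N\<close>.
\<close>

lemma trig_potential_gt_frequency:
  assumes Phi: "\<And>x. 0 < x \<Longrightarrow> x < pi / 2 \<Longrightarrow> m \<le> trig_Phi a b x" and b: "0 \<le> b"
    and r: "0 < r" "r \<le> N" and c: "0 < c" "c \<le> N - max (- m) 0 / r"
    and ne: "\<not> (a = 0 \<and> b = 0 \<and> c = N)" and x: "0 < x" "x < pi / 2"
  shows "c\<^sup>2 + a / x\<^sup>2 < N\<^sup>2 + trig_potential a b x"
proof (cases "m < 0")
  case True
  define d where "d = - m / r"
  have d: "d > 0" "d * r = - m" "c \<le> N - d"
    using True r c by (auto simp: d_def max_def divide_neg_pos)
  have "c\<^sup>2 \<le> (N - d)\<^sup>2" using c d by (intro power_mono) auto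
  also have "\<dots> = N * (N - d) - d * (N - d)" by (simp add: power2_eq_square algebra_simps)
  also have "\<dots> < N * (N - d)" using d c by simp
  also have "\<dots> = N\<^sup>2 - d * N" by (simp add: power2_eq_square algebra_simps)
  also have "\<dots> \<le> N\<^sup>2 + m" using mult_left_mono[OF r(2), of d] d by simp
  finally show ?thesis using trig_potential_ge[OF Phi x] by simp
next
  case False
  then have cN: "c \<le> N" using c by (simp add: max_def)
  then have cN2: "c\<^sup>2 \<le> N\<^sup>2" using c by (intro power_mono) auto
  show ?thesis
  proof (cases "a = 0 \<and> b = 0")
    case True
    then have "c < N" using ne cN by auto
    then have "c\<^sup>2 < N\<^sup>2" using c by (intro power_strict_mono) auto
    then show ?thesis using True by (simp add: trig_potential_def)
  next
    case False
    have "0 \<le> trig_Phi a b y" if "0 < y" "y < pi / 2" for y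
      using Phi[OF that] \<open>\<not> m < 0\<close> by simp
    from trig_potential_gt[OF this x b] False cN2 show ?thesis by auto
  qed
qed

text \<open>
  The counterpart with reversed signs; here \<open>(N + d)\<^sup>2 > N\<^sup>2 + d N \<ge> N\<^sup>2 + M\<close> for \<open>d = M / r > 0\<close>.
\<close>

lemma trig_potential_less_frequency:
  assumes Phi: "\<And>x. 0 < x \<Longrightarrow> x < pi / 2 \<Longrightarrow> trig_Phi a b x \<le> M" and b: "b \<le> 0"
    and r: "0 < r" "r \<le> N" and c: "c \<ge> N + max M 0 / r"
    and ne: "\<not> (a = 0 \<and> b = 0 \<and> c = N)" and x: "0 < x" "x < pi / 2"
  shows "N\<^sup>2 + trig_potential a b x < c\<^sup>2 + a / x\<^sup>2"
proof -
  have Phi': "- M \<le> trig_Phi (- a) (- b) y" if "0 < y" "y < pi / 2" for y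
    using Phi[OF that] by (simp add: trig_Phi_uminus)
  show ?thesis
  proof (cases "M > 0")
    case True
    define d where "d = M / r"
    have d: "d > 0" "d * r = M" "N + d \<le> c" using True r c by (auto simp: d_def max_def)
    have "N\<^sup>2 + M \<le> N\<^sup>2 + d * N" using mult_left_mono[OF r(2), of d] d by simp
    also have "\<dots> < (N + d)\<^sup>2"
      using d r by (simp add: power2_eq_square algebra_simps add_pos_pos)
    also have "\<dots> \<le> c\<^sup>2" using d r by (intro power_mono) auto
    finally show ?thesis using trig_potential_ge[OF Phi' x] by (simp add: trig_potential_uminus)
  next
    case False
    then have cN: "N \<le> c" using c by (simp add: max_def)
    then have cN2: "N\<^sup>2 \<le> c\<^sup>2" using r by (intro power_mono) auto
    show ?thesis
    proof (cases "a = 0 \<and> b = 0")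
      case True
      then have "N < c" using ne cN by auto
      then have "N\<^sup>2 < c\<^sup>2" using r by (intro power_strict_mono) auto
      then show ?thesis using True by (simp add: trig_potential_def)
    next
      case ab: False
      have "0 \<le> trig_Phi (- a) (- b) y" if "0 < y" "y < pi / 2" for y
        using Phi'[OF that] False by simp
      from trig_potential_gt[OF this x] b ab cN2 show ?thesis by (auto simp: trig_potential_uminus)
    qed
  qed
qed

text \<open>
  The bound, which is far from sharp, serves to make the infimum and the supremum of \<open>\<Phi>\<close>
  genuine. Near 0 numerator and denominator are both of third order in \<open>x\<close>.
\<close>

lemma sin_kernel_bounded:
  assumes "0 < x" "x < pi / 2"
  shows "\<bar>(1 - x * cot x) / (sin x)\<^sup>2\<bar> \<le> 27 / 2"
proof -
  note q = first_quadrant[OF assms]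
  have eq: "(1 - x * cot x) / (sin x)\<^sup>2 = (sin x - x * cos x) / sin x ^ 3"
    using q by (simp add: cot_def field_simps power2_eq_square power3_eq_cube)
  have nn: "0 \<le> sin x - x * cos x" using x_cos_le_sin[of x] assms by simp
  have "sin x - x * cos x \<le> x - x * (1 - x\<^sup>2 / 2)"
    using sin_x_le_x[of x] mult_left_mono[OF cos_ge_one_minus[of x], of x] assms by linarith
  then have num: "sin x - x * cos x \<le> x ^ 3 / 2"
    by (simp add: algebra_simps power2_eq_square power3_eq_cube)
  have "x * (1 / 3) \<le> x * (1 - x\<^sup>2 / 6)" using assms q by (intro mult_left_mono) auto
  also have "\<dots> \<le> sin x"
    using sin_ge_cubic[of x] assms by (simp add: algebra_simps power2_eq_square power3_eq_cube)
  finally have "(x / 3) ^ 3 \<le> sin x ^ 3" using assms by (intro power_mono) auto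
  then have den: "x ^ 3 \<le> 27 * sin x ^ 3" by (simp add: power_divide)
  have "(sin x - x * cos x) / sin x ^ 3 \<le> 27 / 2"
    using num den q by (subst pos_divide_le_eq) auto
  moreover have "0 \<le> (sin x - x * cos x) / sin x ^ 3" using nn q by simp
  ultimately show ?thesis unfolding eq by linarith
qed

lemma trig_Phi_lower_bound:
  assumes "0 \<le> b" "0 < x" "x < pi / 2"
  shows "- (\<bar>a\<bar> * (27 / 2)) \<le> trig_Phi a b x"
proof -
  note q = first_quadrant[OF assms(2,3)]
  have "0 \<le> tan x" using q by (simp add: tan_def)
  then have "0 \<le> b * ((1 + x * tan x) / (cos x)\<^sup>2)" using assms by simp
  moreover have "\<bar>a * ((1 - x * cot x) / (sin x)\<^sup>2)\<bar> \<le> \<bar>a\<bar> * (27 / 2)"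
    unfolding abs_mult by (intro mult_left_mono sin_kernel_bounded assms) auto
  ultimately show ?thesis unfolding trig_Phi_def by linarith
qed

lemma jacobi_inf_le:
  assumes "\<bar>\<beta>\<bar> \<le> 1/2" "0 < x" "x < pi / 2"
  shows "jacobi_inf \<alpha> \<beta> \<le> jacobi_Phi \<alpha> \<beta> x"
  unfolding jacobi_inf_def
proof (rule cINF_lower)
  have "\<beta>\<^sup>2 \<le> (1/2)\<^sup>2" using assms(1) by (simp add: abs_le_square_iff[symmetric])
  then have b: "0 \<le> (1 - 4 * \<beta>\<^sup>2) / 16" by (simp add: power2_eq_square)
  show "bdd_below (jacobi_Phi \<alpha> \<beta> ` {0<..<pi / 2})"
    unfolding jacobi_Phi_eq using trig_Phi_lower_bound[OF b] by (intro bdd_belowI2) auto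
qed (use assms in auto)

lemma jacobi_sup_ge:
  assumes "\<bar>\<beta>\<bar> \<ge> 1/2" "0 < x" "x < pi / 2"
  shows "jacobi_Phi \<alpha> \<beta> x \<le> jacobi_sup \<alpha> \<beta>"
  unfolding jacobi_sup_def
proof (rule cSUP_upper)
  have "(1/2)\<^sup>2 \<le> \<beta>\<^sup>2" using assms(1) abs_le_square_iff[of "1/2" \<beta>] by simp
  then have b: "0 \<le> - ((1 - 4 * \<beta>\<^sup>2) / 16)" by (simp add: power2_eq_square)
  have "trig_Phi ((1 - 4 * \<alpha>\<^sup>2) / 16) ((1 - 4 * \<beta>\<^sup>2) / 16) y \<le> \<bar>(1 - 4 * \<alpha>\<^sup>2) / 16\<bar> * (27 / 2)"
    if "0 < y" "y < pi / 2" for y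
    using trig_Phi_lower_bound[OF b that, of "- ((1 - 4 * \<alpha>\<^sup>2) / 16)"]
    unfolding trig_Phi_uminus abs_minus_cancel by simp
  then show "bdd_above (jacobi_Phi \<alpha> \<beta> ` {0<..<pi / 2})"
    unfolding jacobi_Phi_eq by (intro bdd_aboveI2[where M = "\<bar>(1 - 4 * \<alpha>\<^sup>2) / 16\<bar> * (27 / 2)"]) simp
qed (use assms in auto)

section \<open>Inequalities between the zeros\<close>

lemma jacobi_Q_eq:
  "jacobi_Q \<alpha> \<beta> n x = (real n + jacobi_rho \<alpha> \<beta>)\<^sup>2 +
     trig_potential ((1 - 4 * \<alpha>\<^sup>2) / 16) ((1 - 4 * \<beta>\<^sup>2) / 16) (x / 2)"
proof -
  have "(1/4 - t) / (4 * y) = (1 - 4 * t) / 16 / y" for t y :: real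
    by (cases "y = 0") (auto simp: field_simps)
  then show ?thesis by (simp only: jacobi_Q_def trig_potential_def add.assoc)
qed

lemma bessel_potential_eq: "(1/4 - \<alpha>\<^sup>2) / x\<^sup>2 = (1 - 4 * \<alpha>\<^sup>2) / 16 / (x / 2)\<^sup>2" for \<alpha> x :: real
  by (cases "x = 0") (auto simp: field_simps)

lemma abs_eq_half_iff: "\<bar>t\<bar> = 1/2 \<longleftrightarrow> (1 - 4 * t\<^sup>2) / 16 = (0::real)"
proof -
  have "\<bar>t\<bar> = 1/2 \<longleftrightarrow> t\<^sup>2 = (1/2)\<^sup>2" using power2_eq_iff[of t "1/2"] by (auto simp: abs_if)
  then show ?thesis by (simp add: power2_eq_square algebra_simps)
qed

lemma jacobi_rho_gt: 
  assumes "\<alpha> > -1" "\<beta> > -1"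
  shows "0 < 1 + jacobi_rho \<alpha> \<beta>"
  using assms unfolding jacobi_rho_def by argo

lemma jacobi_theta_less:
  assumes ab: "\<alpha> > -1" "\<beta> > -1" and nk: "n \<ge> 1" "1 \<le> k" "k \<le> n"
    and \<beta>: "\<bar>\<beta>\<bar> \<le> 1/2" and c: "0 < c" "c \<le> real n + sigma_up \<alpha> \<beta>"
    and ne: "\<not> (\<bar>\<alpha>\<bar> = 1/2 \<and> \<bar>\<beta>\<bar> = 1/2 \<and> c = real n + jacobi_rho \<alpha> \<beta>)"
  shows "jacobi_theta \<alpha> \<beta> n k < bessel_zero \<alpha> k / c"
proof (rule jacobi_theta_less_bessel_zero[OF ab nk c(1)])
  fix x :: real assume x: "0 < x" "x < pi"
  have "\<beta>\<^sup>2 \<le> (1/2)\<^sup>2" using \<beta> by (simp add: abs_le_square_iff[symmetric])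
  then have b: "0 \<le> (1 - 4 * \<beta>\<^sup>2) / 16" by (simp add: power2_eq_square)
  show "c\<^sup>2 + (1/4 - \<alpha>\<^sup>2) / x\<^sup>2 < jacobi_Q \<alpha> \<beta> n x"
    unfolding jacobi_Q_eq bessel_potential_eq
  proof (rule trig_potential_gt_frequency[where r = "1 + jacobi_rho \<alpha> \<beta>" and m = "jacobi_inf \<alpha> \<beta>"])
    show "jacobi_inf \<alpha> \<beta> \<le> trig_Phi ((1 - 4 * \<alpha>\<^sup>2) / 16) ((1 - 4 * \<beta>\<^sup>2) / 16) y"
      if "0 < y" "y < pi / 2" for y
      using jacobi_inf_le[OF \<beta> that] by (simp add: jacobi_Phi_eq)
    show "0 < 1 + jacobi_rho \<alpha> \<beta>" by (rule jacobi_rho_gt[OF ab])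
    show "c \<le> real n + jacobi_rho \<alpha> \<beta> - max (- jacobi_inf \<alpha> \<beta>) 0 / (1 + jacobi_rho \<alpha> \<beta>)"
      using c(2) by (simp add: sigma_up_def pos_part_def)
    show "\<not> ((1 - 4 * \<alpha>\<^sup>2) / 16 = 0 \<and> (1 - 4 * \<beta>\<^sup>2) / 16 = 0 \<and> c = real n + jacobi_rho \<alpha> \<beta>)"
      using ne unfolding abs_eq_half_iff .
  qed (use x b c nk in auto)
qed

lemma less_jacobi_theta:
  assumes ab: "\<alpha> > -1" "\<beta> > -1" and nk: "n \<ge> 1" "1 \<le> k" "k \<le> n"
    and \<beta>: "\<bar>\<beta>\<bar> \<ge> 1/2" and c: "c \<ge> real n + sigma_down \<alpha> \<beta>"
    and ne: "\<not> (\<bar>\<alpha>\<bar> = 1/2 \<and> \<bar>\<beta>\<bar> = 1/2 \<and> c = real n + jacobi_rho \<alpha> \<beta>)"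
  shows "bessel_zero \<alpha> k / c < jacobi_theta \<alpha> \<beta> n k"
proof -
  have r: "0 < 1 + jacobi_rho \<alpha> \<beta>" by (rule jacobi_rho_gt[OF ab])
  have c': "real n + jacobi_rho \<alpha> \<beta> + max (jacobi_sup \<alpha> \<beta>) 0 / (1 + jacobi_rho \<alpha> \<beta>) \<le> c"
    using c by (simp add: sigma_down_def pos_part_def)
  have N: "1 + jacobi_rho \<alpha> \<beta> \<le> real n + jacobi_rho \<alpha> \<beta>" using nk by simp
  have "0 \<le> max (jacobi_sup \<alpha> \<beta>) 0 / (1 + jacobi_rho \<alpha> \<beta>)" using r by simp
  then have "0 < c" using c' r N by linarith
  then show ?thesis
  proof (rule bessel_zero_less_jacobi_theta[OF ab nk])
    fix x :: real assume x: "0 < x" "x < pi"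
    have "(1/2)\<^sup>2 \<le> \<beta>\<^sup>2" using \<beta> abs_le_square_iff[of "1/2" \<beta>] by simp
    then have b: "(1 - 4 * \<beta>\<^sup>2) / 16 \<le> 0" by (simp add: power2_eq_square)
    show "jacobi_Q \<alpha> \<beta> n x < c\<^sup>2 + (1/4 - \<alpha>\<^sup>2) / x\<^sup>2"
      unfolding jacobi_Q_eq bessel_potential_eq
    proof (rule trig_potential_less_frequency[OF _ b r N c'])
      show "trig_Phi ((1 - 4 * \<alpha>\<^sup>2) / 16) ((1 - 4 * \<beta>\<^sup>2) / 16) y \<le> jacobi_sup \<alpha> \<beta>"
        if "0 < y" "y < pi / 2" for y
        using jacobi_sup_ge[OF \<beta> that] by (simp add: jacobi_Phi_eq)
      show "\<not> ((1 - 4 * \<alpha>\<^sup>2) / 16 = 0 \<and> (1 - 4 * \<beta>\<^sup>2) / 16 = 0 \<and> c = real n + jacobi_rho \<alpha> \<beta>)"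
        using ne unfolding abs_eq_half_iff .
    qed (use x in auto)
  qed
qed

text \<open>
  Both potentials vanish, so the strict comparison holds in one direction for every \<open>c < N\<close> and in the
  other for every \<open>c > N\<close>, where \<open>N = n + \<rho>\<close>. A strict inequality for \<open>c = N\<close> would leave room for a
  contradicting \<open>c\<close>.
\<close>

lemma jacobi_theta_eq:
  assumes ab: "\<alpha> > -1" "\<beta> > -1" and nk: "n \<ge> 1" "1 \<le> k" "k \<le> n"
    and half: "\<bar>\<alpha>\<bar> = 1/2" "\<bar>\<beta>\<bar> = 1/2"
  shows "jacobi_theta \<alpha> \<beta> n k = bessel_zero \<alpha> k / (real n + jacobi_rho \<alpha> \<beta>)"
proof -
  define N where "N = real n + jacobi_rho \<alpha> \<beta>"
  define t where "t = jacobi_theta \<alpha> \<beta> n k"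
  define j where "j = bessel_zero \<alpha> k"
  have N: "N > 0" using jacobi_rho_gt[OF ab] nk(1) unfolding N_def by linarith
  have t: "t > 0" using jacobi_theta_solution[OF ab nk] by (simp add: t_def is_kth_least_def)
  have j: "j > 0" using is_kth_least_bessel_zero[OF ab(1) nk(2)] by (simp add: j_def is_kth_least_def)
  have 0: "(1 - 4 * \<alpha>\<^sup>2) / 16 = 0" "(1 - 4 * \<beta>\<^sup>2) / 16 = 0" using half abs_eq_half_iff by auto
  then have Q: "jacobi_Q \<alpha> \<beta> n x = N\<^sup>2" "(1/4 - \<alpha>\<^sup>2) / x\<^sup>2 = 0" for x
    by (simp_all add: jacobi_Q_eq bessel_potential_eq N_def trig_potential_def)
  have below: "t < j / c" if "0 < c" "c < N" for c
    unfolding t_def j_def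
    using power_strict_mono[of c N 2] that
    by (intro jacobi_theta_less_bessel_zero ab nk) (simp_all add: Q)
  have above: "j / c < t" if "N < c" for c
    unfolding t_def j_def
    using power_strict_mono[of N c 2] that N
    by (intro bessel_zero_less_jacobi_theta ab nk) (simp_all add: Q)
  have "t = j / N"
  proof (rule antisym; rule ccontr)
    assume "\<not> t \<le> j / N"
    then have "j / t < N" using t N by (simp add: field_simps)
    then obtain c where c: "j / t < c" "c < N" using dense by blast
    moreover have "0 < j / t" using j t by simp
    ultimately have "t < j / c" by (intro below) auto
    then show False using c t \<open>0 < j / t\<close> by (simp add: field_simps)
  next
    assume "\<not> j / N \<le> t"
    then have "N < j / t" using t N by (simp add: field_simps)
    then obtain c where c: "N < c" "c < j / t" using dense by blast
    with above[of c] N t show False by (simp add: field_simps)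
  qed
  then show ?thesis by (simp add: t_def j_def N_def)
qed

theorem corollary8p1:
  fixes \<alpha> \<beta> \<sigma> :: real and n k :: nat
  assumes "n \<ge> 1" and "1 \<le> k" and "k \<le> n"
    and "\<alpha> > -1" and "\<beta> > -1"
  shows
    "(\<bar>\<beta>\<bar> \<le> 1/2 \<and> -1 < \<sigma> \<and> \<sigma> \<le> sigma_up \<alpha> \<beta> \<longrightarrow>
        jacobi_theta \<alpha> \<beta> n k \<le> bessel_zero \<alpha> k / (real n + \<sigma>) \<and>
        (\<not> (\<bar>\<alpha>\<bar> = 1/2 \<and> \<bar>\<beta>\<bar> = 1/2 \<and> \<sigma> = (\<alpha> + \<beta> + 1) / 2) \<longrightarrow>
           jacobi_theta \<alpha> \<beta> n k < bessel_zero \<alpha> k / (real n + \<sigma>))) \<and>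
     (\<bar>\<beta>\<bar> \<ge> 1/2 \<and> \<sigma> \<ge> sigma_down \<alpha> \<beta> \<longrightarrow>
        jacobi_theta \<alpha> \<beta> n k \<ge> bessel_zero \<alpha> k / (real n + \<sigma>) \<and>
        (\<not> (\<bar>\<alpha>\<bar> = 1/2 \<and> \<bar>\<beta>\<bar> = 1/2 \<and> \<sigma> = (\<alpha> + \<beta> + 1) / 2) \<longrightarrow>
           jacobi_theta \<alpha> \<beta> n k > bessel_zero \<alpha> k / (real n + \<sigma>))) \<and>
     (\<bar>\<alpha>\<bar> = 1/2 \<and> \<bar>\<beta>\<bar> = 1/2 \<and> \<sigma> = (\<alpha> + \<beta> + 1) / 2 \<longrightarrow>
        jacobi_theta \<alpha> \<beta> n k = bessel_zero \<alpha> k / (real n + \<sigma>))"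
proof -
  let ?exceptional = "\<bar>\<alpha>\<bar> = 1/2 \<and> \<bar>\<beta>\<bar> = 1/2 \<and> \<sigma> = (\<alpha> + \<beta> + 1) / 2"
  have eq: "jacobi_theta \<alpha> \<beta> n k = bessel_zero \<alpha> k / (real n + \<sigma>)" if "?exceptional"
    using jacobi_theta_eq[OF assms(4,5,1-3)] that by (simp add: jacobi_rho_def)
  have up: "jacobi_theta \<alpha> \<beta> n k < bessel_zero \<alpha> k / (real n + \<sigma>)"
    if "\<bar>\<beta>\<bar> \<le> 1/2" "-1 < \<sigma>" "\<sigma> \<le> sigma_up \<alpha> \<beta>" "\<not> ?exceptional"
    using that assms(1) by (intro jacobi_theta_less assms) (auto simp: jacobi_rho_def)
  have down: "bessel_zero \<alpha> k / (real n + \<sigma>) < jacobi_theta \<alpha> \<beta> n k"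
    if "\<bar>\<beta>\<bar> \<ge> 1/2" "\<sigma> \<ge> sigma_down \<alpha> \<beta>" "\<not> ?exceptional"
    using that by (intro less_jacobi_theta assms) (auto simp: jacobi_rho_def)
  show ?thesis
  proof (cases "?exceptional")
    case True
    then show ?thesis using eq by simp
  next
    case False
    then show ?thesis using up down by (meson less_imp_le)
  qed
qed

end
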